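(* Let $r,s_1,s_2\in\mathbb{R}$ and $b_1,b_2,b_3\in\mathbb{R}$ satisfy $$b_1+b_2+b_3>\tfrac12,\qquad b_j+b_k>0\quad(j\neq k),$$ and, for $k\in\{1,2\}$, $$\begin{aligned} s_k+r&\geq0,\\ s_k+r&>-b_{min},\\ s_1+s_2&>-b_{min},\\ s_1+s_2&>\tfrac12-b_1-b_2-b_3,\\ s_1+s_2+r&>\tfrac12-b_k,\\ s_1+s_2+r&>\big(\tfrac12-b_{max}\big)_++\big(\tfrac12-b_{med}\big)_+-b_{min}.\end{aligned}$$ Then there is a constant $C$ depending only on $r,s_1,s_2,b_1,b_2,b_3$ such that for all Schwartz functions $\psi_1,\psi_2,\psi_3$ on $\mathbb{R}^2$, $$\Big|\int_{\mathbb{R}^2}\psi_1(t,x)\psi_2(t,x)\psi_3(t,x)\,dx\,dt\Big|\leq C\,\|\psi_1\|_{X^{s_1,b_1}_+}\|\psi_2\|_{X^{s_2,b_2}_-}\|\psi_3\|_{H^{r,b_3}}.$$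
   Context: Write $\langle y\rangle=\sqrt{1+|y|^2}$ and let $\widetilde\psi(\tau,\xi)$ be the space-time Fourier transform of $\psi(t,x)$, $(t,x)\in\mathbb{R}^{1+1}$. Define $$\|\psi\|_{X^{s,b}_\pm}=\big\|\langle\tau\pm\xi\rangle^b\langle\xi\rangle^s\widetilde\psi(\tau,\xi)\big\|_{L^2_{\tau,\xi}(\mathbb{R}^2)},\qquad \|\psi\|_{H^{s,b}}=\big\|\langle|\tau|-|\xi|\rangle^b\langle\xi\rangle^s\widetilde\psi(\tau,\xi)\big\|_{L^2_{\tau,\xi}(\mathbb{R}^2)}.$$ For real numbers $b_1,b_2,b_3$, $b_{max},b_{med},b_{min}$ denote their maximum, median and minimum. For $a\in\mathbb{R}$, $a_+=a$ if $a>0$ and $a_+=0$ if $a\leq0$. *)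

theory Defs
  imports "HOL-Analysis.Analysis"
begin

text \<open>Iterated directional derivatives; the direction at the head of the list is applied last.\<close>

fun iterated_deriv ::
  "'a list \<Rightarrow> ('a::euclidean_space \<Rightarrow> 'b::real_normed_vector) \<Rightarrow> 'a \<Rightarrow> 'b" where
  "iterated_deriv [] f = f"
| "iterated_deriv (v # vs) f = (\<lambda>z. frechet_derivative (iterated_deriv vs f) (at z) v)"

text \<open>
  All partial derivatives of all orders exist, are (Frechet) differentiable, and decay faster than
  any power. Since every iterated partial derivative is required to be differentiable, the total
  function \<^const>\<open>frechet_derivative\<close> never takes an unspecified value here.
\<close>

definition schwartz :: "('a::euclidean_space \<Rightarrow> complex) \<Rightarrow> bool" where
  "schwartz f \<longleftrightarrow>
     (\<forall>vs. set vs \<subseteq> Basis \<longrightarrow>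
        (\<forall>z. iterated_deriv vs f differentiable (at z)) \<and>
        (\<forall>N. \<exists>B. \<forall>z. (1 + norm z) ^ N * norm (iterated_deriv vs f z) \<le> B))"

text \<open>
  The unnormalised Fourier transform. Other normalisations only rescale the norms below by a fixed
  constant; reversing the sign in the exponent does not change them at all.
\<close>

definition fourier :: "('a::euclidean_space \<Rightarrow> complex) \<Rightarrow> 'a \<Rightarrow> complex" where
  "fourier f w = (LINT z|lborel. exp (- \<i> * of_real (z \<bullet> w)) * f z)"

definition bracket :: "real \<Rightarrow> real" where
  "bracket y = sqrt (1 + \<bar>y\<bar>\<^sup>2)"

text \<open>
  The Bochner integral is 0 for non-integrable functions, so this is the \<open>L\<^sup>2\<close> norm only on square
  integrable functions. It is applied below to weighted Fourier transforms of Schwartz functions,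
  which are square integrable because the weights grow at most polynomially.
\<close>

definition L2_norm :: "('a::euclidean_space \<Rightarrow> complex) \<Rightarrow> real" where
  "L2_norm f = sqrt (LINT w|lborel. (norm (f w))\<^sup>2)"

text \<open>Points of space-time are pairs \<open>(t, x)\<close>, points of frequency space pairs \<open>(\<tau>, \<xi>)\<close>.\<close>

definition X_plus_norm :: "real \<Rightarrow> real \<Rightarrow> (real \<times> real \<Rightarrow> complex) \<Rightarrow> real" where
  "X_plus_norm s b \<psi> =
     L2_norm (\<lambda>(\<tau>, \<xi>). (bracket (\<tau> + \<xi>) powr b * bracket \<xi> powr s) *\<^sub>R fourier \<psi> (\<tau>, \<xi>))"

definition X_minus_norm :: "real \<Rightarrow> real \<Rightarrow> (real \<times> real \<Rightarrow> complex) \<Rightarrow> real" where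
  "X_minus_norm s b \<psi> =
     L2_norm (\<lambda>(\<tau>, \<xi>). (bracket (\<tau> - \<xi>) powr b * bracket \<xi> powr s) *\<^sub>R fourier \<psi> (\<tau>, \<xi>))"

definition H_norm :: "real \<Rightarrow> real \<Rightarrow> (real \<times> real \<Rightarrow> complex) \<Rightarrow> real" where
  "H_norm s b \<psi> =
     L2_norm (\<lambda>(\<tau>, \<xi>). (bracket (\<bar>\<tau>\<bar> - \<bar>\<xi>\<bar>) powr b * bracket \<xi> powr s) *\<^sub>R fourier \<psi> (\<tau>, \<xi>))"

definition med3 :: "real \<Rightarrow> real \<Rightarrow> real \<Rightarrow> real" where
  "med3 a b c = sort [a, b, c] ! 1"

definition pos_part :: "real \<Rightarrow> real" where
  "pos_part a = (if a > 0 then a else 0)"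

end

(*
  In null coordinates \<sigma> = \<tau> + \<xi> or \<tau> - \<xi> the weight < |\<tau>| - |\<xi>| > is the smaller of the two brackets
  <\<tau> + \<xi>>, <\<tau> - \<xi>>, so by Fourier inversion the claim becomes a bound for a trilinear convolution form
  whose weight is a product of powers of three brackets <\<sigma>_i> and three brackets <\<xi>_i>, where
  \<xi>_1 + \<xi>_2 + \<xi>_3 = 0 and (up to exchanging the indices 1 and 2) \<sigma>_1 + \<sigma>_2 + \<sigma>_3 = 2 \<xi>_1.

  Fix a > 1/2 close to 1/2. The form with weight <p>^-a <q>^-a is bounded on L^2 by Cauchy-Schwarz
  whenever p and q are linearly independent forms, each in one of the three frequencies; this
  applies to every pair (\<sigma>_i, \<xi>_j) and to (\<sigma>_1, \<sigma>_2), (\<sigma>_1, \<sigma>_3). It remains to dominate the given weight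
  pointwise by a sum of such pairs. On the level of dyadic logarithms this says that a function of
  six natural numbers, linear on each cone of equally ordered arguments, is nonnegative. Such a
  function is the sum of its values on the layers {argument >= t}, so only arguments 0 and 1 have
  to be examined, and there the hypotheses of the theorem are exactly what is needed.
*)

theory Submission
  imports Defs "HOL-Probability.Probability" "HOL-Real_Asymp.Real_Asymp"
begin

text \<open>Two modulations of the same null type, such as \<tau> - \<xi> in the second and in the
  third frequency, become dependent or constant once any frequency is fixed. Hence
  \<open>l2 + l3\<close> is missing from the minimum and \<open>l1\<close> plays a special role; the
  third modulation never takes that role, which is why \<open>b1\<close> and \<open>b2\<close>, but
  not \<open>b3\<close>, enter a separate condition with 1/2. The inequality between logarithms
  concerns only configurations that can occur, and rounding to integers spoils the exact relations
  that describe them. Adding a large multiple of the defect makes it true for all six-tuples, so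
  that it can be split into layers freely; for actual frequencies this costs a constant factor.
  Since the domination is pointwise, no dyadic sums arise. Integrability of <t>^(-2a) on the line
  forces a > 1/2. Every condition of the theorem in which 1/2 is to be replaced by a is strict, and
  there are finitely many, so one a serves them all.\<close>

section \<open>Domination of the weight by pairs\<close>

text \<open>
  Here and below \<open>l1, l2, l3\<close> are dyadic logarithms of the brackets of the modulations and
  \<open>n1, n2, n3\<close> those of the brackets of the spatial frequencies. The gain is
  the minimum of \<open>l1 + l2\<close>, \<open>l1 + l3\<close> and all \<open>l\<^sub>i + n\<^sub>j\<close>, written as a sum of lattice
  polynomials; these commute with passing to layers.
\<close>

definition gain :: "nat \<Rightarrow> nat \<Rightarrow> nat \<Rightarrow> nat \<Rightarrow> nat \<Rightarrow> nat \<Rightarrow> nat" where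
  "gain l1 l2 l3 n1 n2 n3 =
     min l1 (min l2 l3) + min (min n1 (min n2 n3)) (max l1 (min l2 l3))"

text \<open>
  The defect measures how far the arguments are from having two equal maxima among \<open>n1, n2, n3\<close>
  and among \<open>l1, l2, l3, n1\<close>; for actual frequencies it is bounded.
\<close>

definition defect :: "nat \<Rightarrow> nat \<Rightarrow> nat \<Rightarrow> nat \<Rightarrow> nat \<Rightarrow> nat \<Rightarrow> nat" where
  "defect l1 l2 l3 n1 n2 n3 =
     (n1 - max n2 n3) + (n2 - max n1 n3) + (n3 - max n1 n2) +
     (l1 - max l2 (max l3 n1)) + (l2 - max l1 (max l3 n1)) + (l3 - max l1 (max l2 n1)) +
     (n1 - max l1 (max l2 l3))"

section \<open>Splitting natural numbers into layers\<close>

lemma nat_layer: "(x::nat) = min x 1 + (x - 1)"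
  by simp

text \<open>Truncated subtraction counts the levels that \<open>x\<close> reaches and
  \<open>y\<close> does not, so it splits level by level.\<close>

lemma nat_diff_layer: "(x::nat) - y = (min x 1 - min y 1) + ((x - 1) - (y - 1))"
  by (simp add: min_def)

text \<open>Truncation at 1 and removal of the lowest layer are monotone maps, and these commute
  with \<open>min\<close> and \<open>max\<close>.\<close>

lemma min_max_layer:
  fixes x y :: nat
  shows "min (min x 1) (min y 1) = min (min x y) 1" "max (min x 1) (min y 1) = min (max x y) 1"
    "min (x - 1) (y - 1) = min x y - 1" "max (x - 1) (y - 1) = max x y - 1"
  by (simp_all add: min_def max_def)

lemma gain_layer:
  "gain l1 l2 l3 n1 n2 n3 =
     gain (min l1 1) (min l2 1) (min l3 1) (min n1 1) (min n2 1) (min n3 1) +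
     gain (l1 - 1) (l2 - 1) (l3 - 1) (n1 - 1) (n2 - 1) (n3 - 1)"
  unfolding gain_def min_max_layer
  using nat_layer[of "min l1 (min l2 l3)"]
    nat_layer[of "min (min n1 (min n2 n3)) (max l1 (min l2 l3))"] by linarith

lemma defect_layer:
  "defect l1 l2 l3 n1 n2 n3 =
     defect (min l1 1) (min l2 1) (min l3 1) (min n1 1) (min n2 1) (min n3 1) +
     defect (l1 - 1) (l2 - 1) (l3 - 1) (n1 - 1) (n2 - 1) (n3 - 1)"
  unfolding defect_def min_max_layer
  using nat_diff_layer[of n1 "max n2 n3"] nat_diff_layer[of n2 "max n1 n3"]
    nat_diff_layer[of n3 "max n1 n2"] nat_diff_layer[of l1 "max l2 (max l3 n1)"]
    nat_diff_layer[of l2 "max l1 (max l3 n1)"] nat_diff_layer[of l3 "max l1 (max l2 n1)"]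
    nat_diff_layer[of n1 "max l1 (max l2 l3)"] by linarith

text \<open>The assumptions encode nonnegativity of \<open>excess\<close> at 0/1 configurations
  without defect. In the \<open>S\<close> block all spatial variables are 1; one modulation is 1 in
  \<open>S0\<close> and \<open>S1\<close>, two in \<open>S2\<close>, three in \<open>S3\<close>, and
  the multiple of \<open>a\<close> is the gain there. With \<open>l1\<close> alone equal to 1 the
  gain is already 1, because the vanishing sum \<open>l2 + l3\<close> is not an admissible pair;
  this explains the asymmetry between \<open>S0\<close> and \<open>S1\<close>.\<close>

locale exponents =
  fixes a b1 b2 b3 s1 s2 r :: real
  assumes a: "a > 0"
    and bsum: "b1 + b2 + b3 \<ge> a"
    and b12: "b1 + b2 \<ge> 0" and b13: "b1 + b3 \<ge> 0" and b23: "b2 + b3 \<ge> 0"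
    and s1r: "s1 + r \<ge> 0" and s2r: "s2 + r \<ge> 0"
    and s1rb: "s1 + r + b1 \<ge> 0" "s1 + r + b2 \<ge> 0" "s1 + r + b3 \<ge> 0"
    and s12b: "s1 + s2 + b1 \<ge> 0" "s1 + s2 + b2 \<ge> 0" "s1 + s2 + b3 \<ge> 0"
    and s12: "s1 + s2 + b1 + b2 + b3 \<ge> a"
    and S0: "s1 + s2 + r + b2 \<ge> 0" "s1 + s2 + r + b3 \<ge> 0"
    and S1: "s1 + s2 + r + b1 \<ge> a"
    and S2: "s1 + s2 + r + b1 + b2 \<ge> a" "s1 + s2 + r + b1 + b3 \<ge> a" "s1 + s2 + r + b2 + b3 \<ge> a"
    and S3: "s1 + s2 + r + b1 + b2 + b3 \<ge> 2 * a"
begin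

text \<open>One unit of defect has to outweigh the worst value of all other terms at 0/1 arguments;
  the gain is at most 2 there, hence the summand \<open>2 * a\<close>.\<close>

definition penalty :: real where
  "penalty = \<bar>b1\<bar> + \<bar>b2\<bar> + \<bar>b3\<bar> + \<bar>s1\<bar> + \<bar>s2\<bar> + \<bar>r\<bar> + 2 * a"

definition excess :: "nat \<Rightarrow> nat \<Rightarrow> nat \<Rightarrow> nat \<Rightarrow> nat \<Rightarrow> nat \<Rightarrow> real" where
  "excess l1 l2 l3 n1 n2 n3 =
     b1 * l1 + b2 * l2 + b3 * l3 + s1 * n1 + s2 * n2 + r * n3
     - a * gain l1 l2 l3 n1 n2 n3 + penalty * defect l1 l2 l3 n1 n2 n3"

lemma excess_layer:
  "excess l1 l2 l3 n1 n2 n3 =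
     excess (min l1 1) (min l2 1) (min l3 1) (min n1 1) (min n2 1) (min n3 1) +
     excess (l1 - 1) (l2 - 1) (l3 - 1) (n1 - 1) (n2 - 1) (n3 - 1)"
proof -
  have *: "c * real x = c * real (min x 1) + c * real (x - 1)" for c x
    by (metis nat_layer distrib_left of_nat_add)
  show ?thesis
    unfolding excess_def gain_layer[of l1 l2 l3 n1 n2 n3] defect_layer[of l1 l2 l3 n1 n2 n3]
      *[of _ l1] *[of _ l2] *[of _ l3] *[of _ n1] *[of _ n2] *[of _ n3] of_nat_add distrib_left
    by linarith
qed

lemma excess_01:
  assumes "l1 \<le> 1" "l2 \<le> 1" "l3 \<le> 1" "n1 \<le> 1" "n2 \<le> 1" "n3 \<le> 1"
  shows "excess l1 l2 l3 n1 n2 n3 \<ge> 0"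
proof -
  have *: "- \<bar>c\<bar> \<le> c * real x" if "x \<le> 1" for c x
    using that by (cases x) auto
  have lin: "b1 * l1 + b2 * l2 + b3 * l3 + s1 * n1 + s2 * n2 + r * n3 \<ge> 2 * a - penalty"
    using assms[THEN *, of b1] assms[THEN *, of b2] assms[THEN *, of b3]
      assms[THEN *, of s1] assms[THEN *, of s2] assms[THEN *, of r]
    unfolding penalty_def by linarith
  show ?thesis
  proof (cases "defect l1 l2 l3 n1 n2 n3 = 0")
    case False
    have "gain l1 l2 l3 n1 n2 n3 \<le> 2"
      using assms unfolding gain_def by linarith
    then have "a * gain l1 l2 l3 n1 n2 n3 \<le> a * 2"
      using a by (intro mult_left_mono) auto
    moreover have "penalty * 1 \<le> penalty * defect l1 l2 l3 n1 n2 n3"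
      using False a by (intro mult_left_mono) (auto simp: penalty_def)
    ultimately show ?thesis
      using lin unfolding excess_def by linarith
  next
    case True
    \<comment> \<open>These are configurations with exactly two spatial variables equal to 1 and two
      or three modulations equal to 1; they follow by adding assumptions.\<close>
    have pairs: "s1 + s2 + b1 + b2 \<ge> 0" "s1 + s2 + b1 + b3 \<ge> 0" "s1 + s2 + b2 + b3 \<ge> 0"
      "s1 + r + b1 + b2 \<ge> 0" "s1 + r + b1 + b3 \<ge> 0" "s1 + r + b2 + b3 \<ge> 0"
      "s2 + r + b1 + b2 \<ge> 0" "s2 + r + b1 + b3 \<ge> 0" "s2 + r + b2 + b3 \<ge> 0"
      "s1 + r + b1 + b2 + b3 \<ge> a" "s2 + r + b1 + b2 + b3 \<ge> a"
      using b12 b13 b23 s12b s1r s2r bsum by linarith+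
    have "l1 = 0 \<or> l1 = 1" "l2 = 0 \<or> l2 = 1" "l3 = 0 \<or> l3 = 1"
      "n1 = 0 \<or> n1 = 1" "n2 = 0 \<or> n2 = 1" "n3 = 0 \<or> n3 = 1"
      using assms by auto
    \<comment> \<open>Zero defect excludes a single 1 among \<open>n1, n2, n3\<close> and a single 1
      among \<open>l1, l2, l3, n1\<close>. Each configuration that remains is trivial or one of the
      listed inequalities.\<close>
    then show ?thesis
      using True unfolding excess_def gain_def defect_def
      by (elim disjE; simp)
        (insert pairs bsum b12 b13 b23 s1r s2r s1rb s12b s12 S0 S1 S2 S3, simp_all only: ac_simps)
  qed
qed

text \<open>The bottom layer has 0/1 arguments, and the remaining layers have a smaller sum unless
  all arguments vanish.\<close>

lemma excess_nonneg: "excess l1 l2 l3 n1 n2 n3 \<ge> 0"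
proof (induction "l1 + l2 + l3 + n1 + n2 + n3" arbitrary: l1 l2 l3 n1 n2 n3 rule: less_induct)
  case less
  show ?case
  proof (cases "l1 + l2 + l3 + n1 + n2 + n3 = 0")
    case True
    then show ?thesis by (intro excess_01) auto
  next
    case False
    then have "excess (l1 - 1) (l2 - 1) (l3 - 1) (n1 - 1) (n2 - 1) (n3 - 1) \<ge> 0"
      by (intro less) linarith
    then show ?thesis
      using excess_01[of "min l1 1" "min l2 1" "min l3 1" "min n1 1" "min n2 1" "min n3 1"]
        excess_layer[of l1 l2 l3 n1 n2 n3] by simp
  qed
qed

end

text \<open>The minimum is attained at an admissible pair, so 2 to the power
  \<open>- a * gain\<close> is, up to rounding, the weight of a single pair.\<close>

lemma gain_cases:
  "gain l1 l2 l3 n1 n2 n3 \<in>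
     {l1 + l2, l1 + l3, l1 + n1, l1 + n2, l1 + n3, l2 + n1, l2 + n2, l2 + n3,
      l3 + n1, l3 + n2, l3 + n3}"
  unfolding gain_def min_def max_def by (simp split: if_splits)

section \<open>Dyadic logarithms and the pointwise bound\<close>

definition dyad :: "real \<Rightarrow> nat" where
  "dyad x = nat \<lfloor>log 2 x\<rfloor>"

lemma dyad:
  assumes "x \<ge> 1"
  shows "2 ^ dyad x \<le> x" "x < 2 * 2 ^ dyad x"
proof -
  have eq: "real_of_int \<lfloor>log 2 x\<rfloor> = real (dyad x)"
    using assms by (simp add: dyad_def)
  have *: "x = 2 powr log 2 x"
    using assms by simp
  have "2 powr real (dyad x) \<le> x"
    by (subst *) (simp flip: eq)
  then show "2 ^ dyad x \<le> x"
    by (simp add: powr_realpow)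
  have "x < 2 powr (real (dyad x) + 1)"
    by (subst *) (simp flip: eq)
  then show "x < 2 * 2 ^ dyad x"
    by (simp add: powr_add powr_realpow)
qed

text \<open>Rounding the logarithm down loses something only for negative \<open>b\<close>; the
  absolute value covers both signs at once.\<close>

lemma powr_dyad_le:
  fixes x b :: real
  assumes "x \<ge> 1"
  shows "x powr - b \<le> 2 powr (\<bar>b\<bar> - b * dyad x)"
proof -
  define d where "d = real (dyad x)"
  have d: "2 powr d \<le> x" "x \<le> 2 powr (d + 1)"
    using dyad[OF assms] by (simp_all add: powr_add powr_realpow d_def)
  show ?thesis
  proof (cases "b \<ge> 0")
    case True
    then have "x powr - b \<le> (2 powr d) powr - b"
      using d by (intro powr_mono2') auto
    also have "\<dots> = 2 powr (- b * d)"
      by (simp add: powr_powr mult.commute)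
    also have "\<dots> \<le> 2 powr (\<bar>b\<bar> - b * d)"
      using True by (intro powr_mono) auto
    finally show ?thesis by (simp add: d_def)
  next
    case False
    then have "x powr - b \<le> (2 powr (d + 1)) powr - b"
      using d assms by (intro powr_mono2) auto
    also have "\<dots> = 2 powr (\<bar>b\<bar> - b * d)"
      using False by (simp add: powr_powr algebra_simps)
    finally show ?thesis by (simp add: d_def)
  qed
qed

lemma powr_dyad_ge:
  fixes x a :: real
  assumes "x \<ge> 1" "a \<ge> 0"
  shows "2 powr (- a * dyad x) \<le> 2 powr a * x powr - a"
proof -
  have "(2 * 2 ^ dyad x) powr - a \<le> x powr - a"
    using dyad[OF assms(1)] assms by (intro powr_mono2') auto
  also have "(2 * 2 ^ dyad x) powr - a = 2 powr - a * 2 powr (- a * dyad x)"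
    by (simp add: powr_mult powr_powr mult.commute flip: powr_realpow)
  finally show ?thesis
    by (simp add: powr_minus field_simps)
qed

lemma dyad_le:
  assumes "x \<ge> 1" "x < 2 ^ Suc k"
  shows "dyad x \<le> k"
proof -
  have "(2::real) ^ dyad x < 2 ^ Suc k"
    using dyad(1)[OF assms(1)] assms(2) by linarith
  then have "dyad x < Suc k"
    by (rule power_less_imp_less_exp[rotated]) simp
  then show ?thesis by simp
qed

lemma power_dyad_less:
  assumes "x \<ge> 1" "dyad x \<le> k"
  shows "x < 2 * 2 ^ k"
  using dyad(2)[OF assms(1)] power_increasing[OF assms(2), of "2::real"] by linarith

text \<open>If all terms on the right lie below \<open>2 * 2 ^ k\<close>, a sum of two lies below
  \<open>2 ^ (k + 2)\<close>, and a further doubled term raises this to \<open>2 ^ (k + 3)\<close>.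
  So three summands of the defect are at most 1 and four are at most 2.\<close>

lemma defect_dyad_le:
  assumes "L1 \<ge> 1" "L2 \<ge> 1" "L3 \<ge> 1" "N1 \<ge> 1" "N2 \<ge> 1" "N3 \<ge> 1"
    and "N1 \<le> N2 + N3" "N2 \<le> N1 + N3" "N3 \<le> N1 + N2"
    and "L1 \<le> L2 + L3 + 2 * N1" "L2 \<le> L1 + L3 + 2 * N1" "L3 \<le> L1 + L2 + 2 * N1"
    and "N1 \<le> L1 + L2 + L3"
  shows "defect (dyad L1) (dyad L2) (dyad L3) (dyad N1) (dyad N2) (dyad N3) \<le> 11"
proof -
  have two: "dyad x - max (dyad y) (dyad z) \<le> 1"
    if "x \<ge> 1" "y \<ge> 1" "z \<ge> 1" "x \<le> y + z" for x y z
  proof -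
    define k where "k = max (dyad y) (dyad z)"
    have "y < 2 * 2 ^ k" "z < 2 * 2 ^ k"
      using that by (auto intro!: power_dyad_less simp: k_def)
    then have "x < 2 ^ Suc (k + 1)"
      using that by simp
    then show ?thesis
      using dyad_le[of x "k + 1"] that by (simp add: k_def)
  qed
  have three: "dyad x - max (dyad y) (max (dyad z) (dyad w)) \<le> 2"
    if "x \<ge> 1" "y \<ge> 1" "z \<ge> 1" "w \<ge> 1" "x \<le> y + z + 2 * w" for x y z w
  proof -
    define k where "k = max (dyad y) (max (dyad z) (dyad w))"
    have "y < 2 * 2 ^ k" "z < 2 * 2 ^ k" "w < 2 * 2 ^ k"
      using that by (auto intro!: power_dyad_less simp: k_def)
    then have "x < 2 ^ Suc (k + 2)"
      using that by simp
    then show ?thesis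
      using dyad_le[of x "k + 2"] that by (simp add: k_def)
  qed
  have "defect (dyad L1) (dyad L2) (dyad L3) (dyad N1) (dyad N2) (dyad N3)
      \<le> 1 + 1 + 1 + 2 + 2 + 2 + 2"
    unfolding defect_def using assms by (intro add_mono two three) auto
  then show ?thesis by simp
qed

text \<open>In base 2 logarithms this is \<open>excess_nonneg\<close>. Of the 12 penalties one pays
  for rounding the six factors and 11 for the defect; \<open>2 * a\<close> pays for returning from
  the two logarithms of a pair to the actual sizes.\<close>

lemma (in exponents) weight_le:
  assumes "L1 \<ge> 1" "L2 \<ge> 1" "L3 \<ge> 1" "N1 \<ge> 1" "N2 \<ge> 1" "N3 \<ge> 1"
    and "N1 \<le> N2 + N3" "N2 \<le> N1 + N3" "N3 \<le> N1 + N2"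
    and "L1 \<le> L2 + L3 + 2 * N1" "L2 \<le> L1 + L3 + 2 * N1" "L3 \<le> L1 + L2 + 2 * N1"
    and "N1 \<le> L1 + L2 + L3"
  shows "L1 powr - b1 * L2 powr - b2 * L3 powr - b3 * N1 powr - s1 * N2 powr - s2 * N3 powr - r
    \<le> 2 powr (12 * penalty + 2 * a) *
      (L1 powr - a * (L2 powr - a + L3 powr - a) +
       (L1 powr - a + L2 powr - a + L3 powr - a) * (N1 powr - a + N2 powr - a + N3 powr - a))"
    (is "?W \<le> _ * ?E")
proof -
  let ?l1 = "dyad L1" and ?l2 = "dyad L2" and ?l3 = "dyad L3"
  let ?n1 = "dyad N1" and ?n2 = "dyad N2" and ?n3 = "dyad N3"
  let ?m = "gain ?l1 ?l2 ?l3 ?n1 ?n2 ?n3"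
  define K where "K = \<bar>b1\<bar> + \<bar>b2\<bar> + \<bar>b3\<bar> + \<bar>s1\<bar> + \<bar>s2\<bar> + \<bar>r\<bar>"
  have "penalty \<ge> 0" and penalty_ge: "K \<le> penalty"
    using a by (simp_all add: penalty_def K_def)
  have "?W \<le> 2 powr (\<bar>b1\<bar> - b1 * ?l1) * 2 powr (\<bar>b2\<bar> - b2 * ?l2) * 2 powr (\<bar>b3\<bar> - b3 * ?l3) *
      2 powr (\<bar>s1\<bar> - s1 * ?n1) * 2 powr (\<bar>s2\<bar> - s2 * ?n2) * 2 powr (\<bar>r\<bar> - r * ?n3)"
    using assms by (intro mult_mono powr_dyad_le mult_nonneg_nonneg) auto
  also have "\<dots> = 2 powr (K -
      (b1 * ?l1 + b2 * ?l2 + b3 * ?l3 + s1 * ?n1 + s2 * ?n2 + r * ?n3))"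
    by (simp only: powr_add[symmetric]) (simp add: K_def algebra_simps)
  also have "\<dots> \<le> 2 powr (12 * penalty - a * ?m)"
  proof (intro powr_mono)
    have "penalty * defect ?l1 ?l2 ?l3 ?n1 ?n2 ?n3 \<le> penalty * 11"
      using defect_dyad_le[OF assms] \<open>penalty \<ge> 0\<close> by (intro mult_left_mono) auto
    then show "K -
      (b1 * ?l1 + b2 * ?l2 + b3 * ?l3 + s1 * ?n1 + s2 * ?n2 + r * ?n3) \<le> 12 * penalty - a * ?m"
      using excess_nonneg[of ?l1 ?l2 ?l3 ?n1 ?n2 ?n3] penalty_ge unfolding excess_def by linarith
  qed simp
  also have "\<dots> = 2 powr (12 * penalty) * 2 powr (- a * ?m)"
    by (simp flip: powr_add)
  also have "2 powr (- a * ?m) \<le> 2 powr (2 * a) * ?E"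
  proof -
    have *: "2 powr (- a * ?m) \<le> 2 powr (2 * a) * (x powr - a * y powr - a)"
      if "?m = dyad x + dyad y" "x \<ge> 1" "y \<ge> 1" for x y
    proof -
      have "2 powr (- a * ?m) = 2 powr (- a * dyad x) * 2 powr (- a * dyad y)"
        unfolding that by (simp add: algebra_simps flip: powr_add)
      also have "\<dots> \<le> (2 powr a * x powr - a) * (2 powr a * y powr - a)"
        using that a powr_dyad_ge[of x a] powr_dyad_ge[of y a] by (intro mult_mono) auto
      also have "\<dots> = 2 powr (2 * a) * (x powr - a * y powr - a)"
        by (simp add: algebra_simps flip: powr_add)
      finally show ?thesis .
    qed
    have fin: ?thesis if "?m = dyad x + dyad y" "x \<ge> 1" "y \<ge> 1" "x powr - a * y powr - a \<le> ?E" for x y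
    proof -
      have "2 powr (2 * a) * (x powr - a * y powr - a) \<le> 2 powr (2 * a) * ?E"
        using that by (intro mult_left_mono) auto
      then show ?thesis
        using *[OF that(1-3)] by linarith
    qed
    have E: "?E = L1 powr - a * L2 powr - a
        + L1 powr - a * L3 powr - a
        + L1 powr - a * N1 powr - a
        + L1 powr - a * N2 powr - a
        + L1 powr - a * N3 powr - a
        + L2 powr - a * N1 powr - a
        + L2 powr - a * N2 powr - a
        + L2 powr - a * N3 powr - a
        + L3 powr - a * N1 powr - a
        + L3 powr - a * N2 powr - a
        + L3 powr - a * N3 powr - a"
      by (simp add: algebra_simps)
    have nn: "0 \<le> x powr - a * y powr - a" for x y :: real
      by simp
    have le: "L1 powr - a * L2 powr - a \<le> ?E"
      "L1 powr - a * L3 powr - a \<le> ?E"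
      "L1 powr - a * N1 powr - a \<le> ?E"
      "L1 powr - a * N2 powr - a \<le> ?E"
      "L1 powr - a * N3 powr - a \<le> ?E"
      "L2 powr - a * N1 powr - a \<le> ?E"
      "L2 powr - a * N2 powr - a \<le> ?E"
      "L2 powr - a * N3 powr - a \<le> ?E"
      "L3 powr - a * N1 powr - a \<le> ?E"
      "L3 powr - a * N2 powr - a \<le> ?E"
      "L3 powr - a * N3 powr - a \<le> ?E"
      unfolding E using nn[of L1 L2] nn[of L1 L3] nn[of L1 N1] nn[of L1 N2] nn[of L1 N3]
        nn[of L2 N1] nn[of L2 N2] nn[of L2 N3] nn[of L3 N1] nn[of L3 N2] nn[of L3 N3]
      by linarith+
    show ?thesis
      using gain_cases[of ?l1 ?l2 ?l3 ?n1 ?n2 ?n3]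
      by (elim insertE emptyE) (erule fin; fact assms le)+
  qed
  finally show ?thesis
    by (simp add: powr_add mult.assoc)
qed

section \<open>Schur bounds for trilinear convolution forms\<close>

lemma nn_integral_lborel_reflect:
  fixes f :: "'a::euclidean_space \<Rightarrow> ennreal"
  assumes [measurable]: "f \<in> borel_measurable borel"
  shows "(\<integral>\<^sup>+x. f (c - x) \<partial>lborel) = (\<integral>\<^sup>+x. f x \<partial>lborel)"
proof -
  have "(\<integral>\<^sup>+x. f x \<partial>lborel) = (\<integral>\<^sup>+x. f x \<partial>density (distr lborel borel (\<lambda>x. c + (-1) *\<^sub>R x)) (\<lambda>_. \<bar>-1::real\<bar>^DIM('a)))"
    by (subst lborel_affine[of "-1" c]) auto
  also have "\<dots> = (\<integral>\<^sup>+x. f (c - x) \<partial>lborel)"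
    by (simp add: nn_integral_density nn_integral_distr)
  finally show ?thesis ..
qed

lemma Cauchy_Schwarz_nn_integral_iterated:
  fixes f g :: "'a::euclidean_space \<Rightarrow> 'a \<Rightarrow> ennreal"
  assumes [measurable]: "case_prod f \<in> borel_measurable (lborel \<Otimes>\<^sub>M lborel)"
    "case_prod g \<in> borel_measurable (lborel \<Otimes>\<^sub>M lborel)"
  shows "(\<integral>\<^sup>+x. \<integral>\<^sup>+y. f x y * g x y \<partial>lborel \<partial>lborel)\<^sup>2 \<le>
    (\<integral>\<^sup>+x. \<integral>\<^sup>+y. (f x y)\<^sup>2 \<partial>lborel \<partial>lborel) * (\<integral>\<^sup>+x. \<integral>\<^sup>+y. (g x y)\<^sup>2 \<partial>lborel \<partial>lborel)"
proof -
  have "(\<integral>\<^sup>+z. case_prod f z * case_prod g z \<partial>(lborel \<Otimes>\<^sub>M lborel))\<^sup>2 \<le>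
    (\<integral>\<^sup>+z. (case_prod f z)\<^sup>2 \<partial>(lborel \<Otimes>\<^sub>M lborel)) *
    (\<integral>\<^sup>+z. (case_prod g z)\<^sup>2 \<partial>(lborel \<Otimes>\<^sub>M lborel))"
    by (intro Cauchy_Schwarz_nn_integral) measurable
  then show ?thesis
    by (simp add: lborel.nn_integral_fst[symmetric] split_beta')
qed

text \<open>Values in \<open>ennreal\<close> make the order of integration free for measurable
  integrands. The argument \<open>- x - y\<close> expresses that the three frequencies sum to
  zero.\<close>

definition trilinear ::
  "('a::euclidean_space \<Rightarrow> ennreal) \<Rightarrow> ('a \<Rightarrow> ennreal) \<Rightarrow> ('a \<Rightarrow> ennreal) \<Rightarrow> ('a \<Rightarrow> 'a \<Rightarrow> ennreal) \<Rightarrow> ennreal"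
  where "trilinear f g h M = (\<integral>\<^sup>+x. \<integral>\<^sup>+y. f x * g y * h (- x - y) * M x y \<partial>lborel \<partial>lborel)"

text \<open>
  The three alternatives keep the first, the second or the third frequency fixed.
\<close>

definition schur_bound :: "ennreal \<Rightarrow> ('a::euclidean_space \<Rightarrow> 'a \<Rightarrow> ennreal) \<Rightarrow> bool" where
  "schur_bound K M \<longleftrightarrow> case_prod M \<in> borel_measurable (lborel \<Otimes>\<^sub>M lborel) \<and>
     ((\<forall>x. (\<integral>\<^sup>+y. (M x y)\<^sup>2 \<partial>lborel) \<le> K) \<or> (\<forall>y. (\<integral>\<^sup>+x. (M x y)\<^sup>2 \<partial>lborel) \<le> K) \<or>
      (\<forall>z. (\<integral>\<^sup>+x. (M x (- z - x))\<^sup>2 \<partial>lborel) \<le> K))"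

text \<open>In Cauchy-Schwarz the weight stays with the function of the fixed frequency, where its
  square integrates to at most \<open>K\<close>. The product of the other two functions has a
  factorising square integral, since reflections and translations preserve Lebesgue measure.\<close>

lemma trilinear_le:
  fixes f g h :: "'a::euclidean_space \<Rightarrow> ennreal"
  assumes M: "schur_bound K M"
    and [measurable]: "f \<in> borel_measurable borel" "g \<in> borel_measurable borel" "h \<in> borel_measurable borel"
  shows "(trilinear f g h M)\<^sup>2 \<le>
    K * (\<integral>\<^sup>+x. (f x)\<^sup>2 \<partial>lborel) * (\<integral>\<^sup>+x. (g x)\<^sup>2 \<partial>lborel) * (\<integral>\<^sup>+x. (h x)\<^sup>2 \<partial>lborel)"
proof -
  let ?I = "\<lambda>f. \<integral>\<^sup>+x. (f x)\<^sup>2 \<partial>(lborel :: 'a measure)"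
  have M_meas: "case_prod M \<in> borel_measurable (lborel \<Otimes>\<^sub>M lborel)"
    using M by (simp add: schur_bound_def)
  note [measurable] = M_meas
  have swap: "(\<integral>\<^sup>+x. \<integral>\<^sup>+y. F x y \<partial>lborel \<partial>lborel) = (\<integral>\<^sup>+y. \<integral>\<^sup>+x. F x y \<partial>lborel \<partial>lborel)"
    if "case_prod F \<in> borel_measurable (lborel \<Otimes>\<^sub>M lborel)" for F :: "'a \<Rightarrow> 'a \<Rightarrow> ennreal"
    using lborel_pair.Fubini'[OF that] by simp
  have refl: "(\<integral>\<^sup>+y. F (- x - y) \<partial>lborel) = (\<integral>\<^sup>+y. F y \<partial>lborel)"
    if "F \<in> borel_measurable borel" for F :: "'a \<Rightarrow> ennreal" and x
    using that by (rule nn_integral_lborel_reflect)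
  consider "\<forall>x. (\<integral>\<^sup>+y. (M x y)\<^sup>2 \<partial>lborel) \<le> K" | "\<forall>y. (\<integral>\<^sup>+x. (M x y)\<^sup>2 \<partial>lborel) \<le> K"
    | "\<forall>z. (\<integral>\<^sup>+x. (M x (- z - x))\<^sup>2 \<partial>lborel) \<le> K"
    using M unfolding schur_bound_def by blast
  then show ?thesis
  proof cases
    case 1
    have "(trilinear f g h M)\<^sup>2 = (\<integral>\<^sup>+x. \<integral>\<^sup>+y. (g y * h (- x - y)) * (f x * M x y) \<partial>lborel \<partial>lborel)\<^sup>2"
      unfolding trilinear_def by (simp add: ac_simps)
    also have "\<dots> \<le> (\<integral>\<^sup>+x. \<integral>\<^sup>+y. (g y * h (- x - y))\<^sup>2 \<partial>lborel \<partial>lborel) *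
        (\<integral>\<^sup>+x. \<integral>\<^sup>+y. (f x * M x y)\<^sup>2 \<partial>lborel \<partial>lborel)" (is "_ \<le> _ * ?B")
      by (intro Cauchy_Schwarz_nn_integral_iterated) measurable
    also have "(\<integral>\<^sup>+x. \<integral>\<^sup>+y. (g y * h (- x - y))\<^sup>2 \<partial>lborel \<partial>lborel) =
        (\<integral>\<^sup>+y. \<integral>\<^sup>+x. (g y * h (- y - x))\<^sup>2 \<partial>lborel \<partial>lborel)"
      by (subst swap) (measurable, simp only: minus_diff_commute)
    also have "\<dots> = (\<integral>\<^sup>+y. (g y)\<^sup>2 * ?I h \<partial>lborel)"
      by (simp add: power_mult_distrib nn_integral_cmult refl[of "\<lambda>x. (h x)\<^sup>2"])
    also have "\<dots> = ?I g * ?I h"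
      by (simp add: nn_integral_multc)
    finally have A: "(trilinear f g h M)\<^sup>2 \<le> ?I g * ?I h * ?B" .
    have "?B \<le> (\<integral>\<^sup>+x. (f x)\<^sup>2 * K \<partial>lborel)"
      using 1 by (intro nn_integral_mono) (simp add: power_mult_distrib nn_integral_cmult mult_left_mono)
    also have "\<dots> = ?I f * K"
      by (simp add: nn_integral_multc)
    finally have B: "?B \<le> ?I f * K" .
    from order_trans[OF A mult_left_mono[OF B]] show ?thesis
      by (simp add: ac_simps)
  next
    case 2
    have "(trilinear f g h M)\<^sup>2 = (\<integral>\<^sup>+x. \<integral>\<^sup>+y. (f x * h (- x - y)) * (g y * M x y) \<partial>lborel \<partial>lborel)\<^sup>2"
      unfolding trilinear_def by (simp add: ac_simps)
    also have "\<dots> \<le> (\<integral>\<^sup>+x. \<integral>\<^sup>+y. (f x * h (- x - y))\<^sup>2 \<partial>lborel \<partial>lborel) *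
        (\<integral>\<^sup>+x. \<integral>\<^sup>+y. (g y * M x y)\<^sup>2 \<partial>lborel \<partial>lborel)" (is "_ \<le> _ * ?B")
      by (intro Cauchy_Schwarz_nn_integral_iterated) measurable
    also have "(\<integral>\<^sup>+x. \<integral>\<^sup>+y. (f x * h (- x - y))\<^sup>2 \<partial>lborel \<partial>lborel) = (\<integral>\<^sup>+x. (f x)\<^sup>2 * ?I h \<partial>lborel)"
      by (simp add: power_mult_distrib nn_integral_cmult refl[of "\<lambda>x. (h x)\<^sup>2"])
    also have "\<dots> = ?I f * ?I h"
      by (simp add: nn_integral_multc)
    finally have A: "(trilinear f g h M)\<^sup>2 \<le> ?I f * ?I h * ?B" .
    have "?B =
        (\<integral>\<^sup>+y. \<integral>\<^sup>+x. (g y * M x y)\<^sup>2 \<partial>lborel \<partial>lborel)"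
      by (rule swap) measurable
    also have "\<dots> \<le> (\<integral>\<^sup>+y. (g y)\<^sup>2 * K \<partial>lborel)"
      using 2 by (intro nn_integral_mono) (simp add: power_mult_distrib nn_integral_cmult mult_left_mono)
    also have "\<dots> = ?I g * K"
      by (simp add: nn_integral_multc)
    finally have B: "?B \<le> ?I g * K" .
    from order_trans[OF A mult_left_mono[OF B]] show ?thesis
      by (simp add: ac_simps)
  next
    case 3
    have "(trilinear f g h M)\<^sup>2 = (\<integral>\<^sup>+x. \<integral>\<^sup>+y. (f x * g y) * (h (- x - y) * M x y) \<partial>lborel \<partial>lborel)\<^sup>2"
      unfolding trilinear_def by (simp add: ac_simps)
    also have "\<dots> \<le> (\<integral>\<^sup>+x. \<integral>\<^sup>+y. (f x * g y)\<^sup>2 \<partial>lborel \<partial>lborel) *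
        (\<integral>\<^sup>+x. \<integral>\<^sup>+y. (h (- x - y) * M x y)\<^sup>2 \<partial>lborel \<partial>lborel)" (is "_ \<le> _ * ?B")
      by (intro Cauchy_Schwarz_nn_integral_iterated) measurable
    also have "(\<integral>\<^sup>+x. \<integral>\<^sup>+y. (f x * g y)\<^sup>2 \<partial>lborel \<partial>lborel) = ?I f * ?I g"
      by (simp add: power_mult_distrib nn_integral_cmult nn_integral_multc)
    finally have A: "(trilinear f g h M)\<^sup>2 \<le> ?I f * ?I g * ?B" .
    have "?B =
        (\<integral>\<^sup>+x. \<integral>\<^sup>+z. (h z * M x (- z - x))\<^sup>2 \<partial>lborel \<partial>lborel)"
    proof (rule nn_integral_cong)
      fix x
      show "(\<integral>\<^sup>+y. (h (- x - y) * M x y)\<^sup>2 \<partial>lborel) = (\<integral>\<^sup>+z. (h z * M x (- z - x))\<^sup>2 \<partial>lborel)"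
        using refl[of "\<lambda>y. (h (- x - y) * M x y)\<^sup>2" x] by (simp add: minus_diff_commute)
    qed
    also have "\<dots> = (\<integral>\<^sup>+z. \<integral>\<^sup>+x. (h z * M x (- z - x))\<^sup>2 \<partial>lborel \<partial>lborel)"
      by (rule swap) measurable
    also have "\<dots> \<le> (\<integral>\<^sup>+z. (h z)\<^sup>2 * K \<partial>lborel)"
      using 3 by (intro nn_integral_mono) (simp add: power_mult_distrib nn_integral_cmult mult_left_mono)
    also have "\<dots> = ?I h * K"
      by (simp add: nn_integral_multc)
    finally have B: "?B \<le> ?I h * K" .
    from order_trans[OF A mult_left_mono[OF B]] show ?thesis
      by (simp add: ac_simps)
  qed
qed

text \<open>Up to a factor \<open>sqrt 2\<close> the bracket is \<open>1 + \<bar>t\<bar>\<close>,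
  whose powers have an explicit antiderivative on the half-line; reflection handles negative
  arguments.\<close>

lemma nn_integral_bracket_powr_finite:
  fixes a :: real
  assumes "a > 1"
  shows "(\<integral>\<^sup>+t. bracket t powr - a \<partial>lborel) < \<infinity>"
proof -
  let ?F = "\<lambda>t::real. (1 + t) powr (1 - a) / (1 - a)"
  have lim: "(?F \<longlongrightarrow> 0) at_top"
    using assms by real_asymp
  have *: "(\<integral>\<^sup>+t. ennreal ((1 + t) powr - a) * indicator {0..} t \<partial>lborel) < \<infinity>"
    by (subst nn_integral_FTC_atLeast[where F = ?F and T = 0])
      (use assms lim in \<open>auto intro!: derivative_eq_intros\<close>)
  have pointwise: "bracket t powr - a \<le> sqrt 2 powr a * (1 + \<bar>t\<bar>) powr - a" for t
  proof -
    have "(1 + \<bar>t\<bar>)\<^sup>2 \<le> 2 * (1 + \<bar>t\<bar>\<^sup>2)"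
      using zero_le_power2[of "1 - \<bar>t\<bar>"] by (simp add: power2_eq_square algebra_simps)
    then have "1 + \<bar>t\<bar> \<le> sqrt 2 * bracket t"
      by (simp add: bracket_def real_le_rsqrt flip: real_sqrt_mult)
    then have "sqrt 2 powr a * (sqrt 2 * bracket t) powr - a \<le> sqrt 2 powr a * (1 + \<bar>t\<bar>) powr - a"
      using assms by (intro mult_left_mono powr_mono2') auto
    moreover have "sqrt 2 powr a * (sqrt 2 * bracket t) powr - a = bracket t powr - a"
      by (simp add: powr_mult powr_minus bracket_def)
    ultimately show ?thesis by simp
  qed
  let ?g = "\<lambda>t. ennreal (sqrt 2 powr a * ((1 + t) powr - a)) * indicator {0..} t"
  have g: "(\<integral>\<^sup>+t. ?g t \<partial>lborel) < \<infinity>"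
    using * by (simp add: ennreal_mult mult.assoc nn_integral_cmult ennreal_mult_less_top)
  have "(\<integral>\<^sup>+t. bracket t powr - a \<partial>lborel) \<le> (\<integral>\<^sup>+t. ?g t + ?g (0 - t) \<partial>lborel)"
  proof (rule nn_integral_mono)
    fix t :: real
    show "ennreal (bracket t powr - a) \<le> ?g t + ?g (0 - t)"
      using pointwise[of t] by (cases "t \<ge> 0") (auto simp: add_increasing2 intro: ennreal_leI)
  qed
  also have "\<dots> = (\<integral>\<^sup>+t. ?g t \<partial>lborel) + (\<integral>\<^sup>+t. ?g (0 - t) \<partial>lborel)"
    by (rule nn_integral_add) measurable
  also have "\<dots> = (\<integral>\<^sup>+t. ?g t \<partial>lborel) + (\<integral>\<^sup>+t. ?g t \<partial>lborel)"
    by (subst nn_integral_lborel_reflect) simp_all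
  finally show ?thesis
    by (rule le_less_trans) (use g in simp)
qed

text \<open>A shear in the first coordinate turns the first form into a coordinate and leaves the
  determinant \<open>\<beta> - \<kappa> * \<alpha>\<close> as the coefficient of the second
  coordinate. Rescaling by a number of modulus at least 1 does not increase the integral.\<close>

lemma nn_integral_affine_pair_le:
  fixes G :: "real \<Rightarrow> ennreal"
  assumes [measurable]: "G \<in> borel_measurable borel" and det: "\<bar>\<beta> - \<kappa> * \<alpha>\<bar> \<ge> 1"
  shows "(\<integral>\<^sup>+z. G (fst z + \<alpha> * snd z + c) * G (\<kappa> * fst z + \<beta> * snd z + d) \<partial>lborel)
    \<le> (\<integral>\<^sup>+t. G t \<partial>lborel)\<^sup>2"
proof -
  let ?\<delta> = "\<beta> - \<kappa> * \<alpha>"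
  have "(\<integral>\<^sup>+z. G (fst z + \<alpha> * snd z + c) * G (\<kappa> * fst z + \<beta> * snd z + d) \<partial>lborel) =
    (\<integral>\<^sup>+y. \<integral>\<^sup>+x. G (x + \<alpha> * y + c) * G (\<kappa> * x + \<beta> * y + d) \<partial>lborel \<partial>lborel)"
    by (simp add: lborel_pair.nn_integral_snd[symmetric] flip: lborel_prod)
  also have "\<dots> = (\<integral>\<^sup>+y. \<integral>\<^sup>+x. G x * G (\<kappa> * x + ?\<delta> * y + (d - \<kappa> * c)) \<partial>lborel \<partial>lborel)"
  proof (rule nn_integral_cong)
    fix y
    show "(\<integral>\<^sup>+x. G (x + \<alpha> * y + c) * G (\<kappa> * x + \<beta> * y + d) \<partial>lborel) =
      (\<integral>\<^sup>+x. G x * G (\<kappa> * x + ?\<delta> * y + (d - \<kappa> * c)) \<partial>lborel)"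
      using nn_integral_real_affine[of "\<lambda>x. G (x + \<alpha> * y + c) * G (\<kappa> * x + \<beta> * y + d)" 1 "- \<alpha> * y - c"]
      by (simp add: algebra_simps)
  qed
  also have "\<dots> = (\<integral>\<^sup>+x. \<integral>\<^sup>+y. G x * G (\<kappa> * x + ?\<delta> * y + (d - \<kappa> * c)) \<partial>lborel \<partial>lborel)"
    by (rule lborel_pair.Fubini') measurable
  also have "\<dots> \<le> (\<integral>\<^sup>+x. G x * (\<integral>\<^sup>+t. G t \<partial>lborel) \<partial>lborel)"
  proof (rule nn_integral_mono)
    fix x
    let ?J = "\<integral>\<^sup>+y. G (\<kappa> * x + ?\<delta> * y + (d - \<kappa> * c)) \<partial>lborel"
    have "(\<integral>\<^sup>+t. G t \<partial>lborel) = ennreal \<bar>?\<delta>\<bar> * ?J"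
      using nn_integral_real_affine[of G ?\<delta> "\<kappa> * x + (d - \<kappa> * c)"] det by (force simp: algebra_simps)
    moreover have "1 * ?J \<le> ennreal \<bar>?\<delta>\<bar> * ?J"
      using det by (intro mult_right_mono) auto
    ultimately have "?J \<le> (\<integral>\<^sup>+t. G t \<partial>lborel)" by simp
    then show "(\<integral>\<^sup>+y. G x * G (\<kappa> * x + ?\<delta> * y + (d - \<kappa> * c)) \<partial>lborel) \<le> G x * (\<integral>\<^sup>+t. G t \<partial>lborel)"
      by (simp add: nn_integral_cmult mult_left_mono)
  qed
  also have "\<dots> = (\<integral>\<^sup>+t. G t \<partial>lborel)\<^sup>2"
    by (simp add: nn_integral_multc power2_eq_square)
  finally show ?thesis .
qed

section \<open>Fourier transform of Schwartz functions\<close>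

lemma integral_lborel_affine:
  fixes f :: "'a::euclidean_space \<Rightarrow> 'b::{banach, second_countable_topology}"
  assumes c: "c \<noteq> 0"
  shows "(LINT x|lborel. f x) = \<bar>c\<bar> ^ DIM('a) *\<^sub>R (LINT x|lborel. f (t + c *\<^sub>R x))"
proof (cases "f \<in> borel_measurable borel")
  case True
  note [measurable] = True
  have "(LINT x|lborel. f x) =
      (LINT x|density (distr lborel borel (\<lambda>x. t + c *\<^sub>R x)) (\<lambda>_. \<bar>c\<bar> ^ DIM('a)). f x)"
    using lborel_affine[OF c, of t] by simp
  also have "\<dots> = \<bar>c\<bar> ^ DIM('a) *\<^sub>R (LINT x|lborel. f (t + c *\<^sub>R x))"
    by (simp add: integral_density integral_distr)
  finally show ?thesis .
next
  \<comment> \<open>Both integrals take the default value 0: measurability of the composed function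
    would carry over to \<open>f\<close> through the inverse affine map.\<close>
  case False
  have "\<not> integrable lborel f"
    using False borel_measurable_integrable[of lborel f] by auto
  moreover have "\<not> integrable lborel (\<lambda>x. f (t + c *\<^sub>R x))"
  proof
    assume "integrable lborel (\<lambda>x. f (t + c *\<^sub>R x))"
    then have [measurable]: "(\<lambda>x. f (t + c *\<^sub>R x)) \<in> borel_measurable borel"
      by simp
    have "(\<lambda>y. (\<lambda>x. f (t + c *\<^sub>R x)) ((1 / c) *\<^sub>R (y - t))) \<in> borel_measurable borel"
      by measurable
    then show False using False c by simp
  qed
  ultimately show ?thesis
    by (simp add: not_integrable_integral_eq)
qed

lemma integrable_lborel_affine:
  fixes f :: "'a::euclidean_space \<Rightarrow> 'b::{banach, second_countable_topology}"
  assumes c: "c \<noteq> 0" and f: "integrable lborel f"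
  shows "integrable lborel (\<lambda>x. f (t + c *\<^sub>R x))"
proof -
  have [measurable]: "f \<in> borel_measurable borel"
    using borel_measurable_integrable[OF f] by simp
  have "integrable (density (distr lborel borel (\<lambda>x. t + c *\<^sub>R x)) (\<lambda>_. \<bar>c\<bar> ^ DIM('a))) f"
    using f lborel_affine[OF c, of t] by simp
  then have "integrable lborel (\<lambda>x. \<bar>c\<bar> ^ DIM('a) *\<^sub>R f (t + c *\<^sub>R x))"
    by (simp add: integrable_density integrable_distr_eq)
  then have "integrable lborel (\<lambda>x. inverse (\<bar>c\<bar> ^ DIM('a)) *\<^sub>R \<bar>c\<bar> ^ DIM('a) *\<^sub>R f (t + c *\<^sub>R x))"
    by (rule integrable_scaleR_right)
  then show ?thesis using c by simp
qed

text \<open>For a non-integrable \<open>f\<close> the left side is 0 by convention.\<close>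

lemma ennreal_norm_integral_le:
  fixes f :: "'a \<Rightarrow> 'b::{banach, second_countable_topology}"
  shows "ennreal (norm (LINT x|M. f x)) \<le> (\<integral>\<^sup>+x. norm (f x) \<partial>M)"
  by (cases "integrable M f") (simp_all add: integral_norm_bound_ennreal not_integrable_integral_eq)

lemma bracket_pos [simp]: "bracket x > 0"
  by (simp add: bracket_def add_pos_nonneg)

lemma bracket_ge_1: "bracket x \<ge> 1"
  by (simp add: bracket_def)

lemma bracket_le: "bracket x \<le> 1 + \<bar>x\<bar>"
  unfolding bracket_def by (rule real_le_lsqrt) (auto simp: power2_eq_square algebra_simps)

lemma borel_measurable_bracket [measurable]: "bracket \<in> borel_measurable borel"
  unfolding bracket_def[abs_def] by measurable

text \<open>Each coordinate receives two of the four powers, and <t>^(-2) is integrable on the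
  line.\<close>

lemma integrable_inverse_power_plane:
  "integrable lborel (\<lambda>z::real \<times> real. 1 / (1 + norm z) ^ 4)"
proof (rule integrableI_bounded)
  let ?w = "\<lambda>t. ennreal (bracket t powr - 2)"
  have "(\<integral>\<^sup>+z. ennreal (norm (1 / (1 + norm (z::real \<times> real)) ^ 4)) \<partial>lborel) \<le>
      (\<integral>\<^sup>+z. ?w (fst z) * ?w (snd z) \<partial>(lborel :: (real \<times> real) measure))"
  proof (rule nn_integral_mono)
    fix z :: "real \<times> real"
    have b: "bracket (fst z) \<le> 1 + norm z" "bracket (snd z) \<le> 1 + norm z"
      using bracket_le[of "fst z"] bracket_le[of "snd z"] norm_fst_le[of "fst z" "snd z"]
        norm_snd_le[of "snd z" "fst z"]
      by simp_all
    have "(bracket (fst z))\<^sup>2 * (bracket (snd z))\<^sup>2 \<le> (1 + norm z)\<^sup>2 * (1 + norm z)\<^sup>2"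
      using b by (intro mult_mono power_mono) (auto simp: less_imp_le)
    also have "\<dots> = (1 + norm z) ^ 4"
      by (simp flip: power_add)
    finally have le: "(bracket (fst z))\<^sup>2 * (bracket (snd z))\<^sup>2 \<le> (1 + norm z) ^ 4" .
    have "1 / (1 + norm z) ^ 4 \<le> 1 / ((bracket (fst z))\<^sup>2 * (bracket (snd z))\<^sup>2)"
      using le by (intro divide_left_mono) (auto intro!: mult_pos_pos zero_less_power add_pos_nonneg)
    also have "\<dots> = bracket (fst z) powr - 2 * bracket (snd z) powr - 2"
      using powr_realpow[OF bracket_pos, of _ 2] by (simp add: powr_minus divide_inverse)
    finally show "ennreal (norm (1 / (1 + norm z) ^ 4)) \<le> ?w (fst z) * ?w (snd z)"
      by (simp flip: ennreal_mult)
  qed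
  also have "\<dots> = (\<integral>\<^sup>+x. \<integral>\<^sup>+y. ?w x * ?w y \<partial>lborel \<partial>lborel)"
    by (simp add: lborel.nn_integral_fst[symmetric] flip: lborel_prod)
  also have "\<dots> = (\<integral>\<^sup>+t. ?w t \<partial>lborel) * (\<integral>\<^sup>+t. ?w t \<partial>lborel)"
    by (simp add: nn_integral_cmult nn_integral_multc)
  also have "\<dots> < \<infinity>"
    using nn_integral_bracket_powr_finite[of 2] by (simp add: ennreal_mult_less_top)
  finally show "(\<integral>\<^sup>+z. ennreal (norm (1 / (1 + norm (z::real \<times> real)) ^ 4)) \<partial>lborel) < \<infinity>" .
qed measurable

lemma integrable_of_decay:
  fixes f :: "real \<times> real \<Rightarrow> 'b::{banach, second_countable_topology}"
  assumes "f \<in> borel_measurable borel" "\<And>z. (1 + norm z) ^ 4 * norm (f z) \<le> B"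
  shows "integrable lborel f"
proof (rule Bochner_Integration.integrable_bound)
  show "integrable lborel (\<lambda>z::real \<times> real. B * (1 / (1 + norm z) ^ 4))"
    using integrable_inverse_power_plane by (rule integrable_mult_right)
  show "AE z in lborel. norm (f z) \<le> norm (B * (1 / (1 + norm z) ^ 4))"
  proof (intro AE_I2)
    fix z :: "real \<times> real"
    have pos: "(1 + norm z) ^ 4 > 0"
      by (intro zero_less_power) (simp add: add_pos_nonneg)
    then have "norm (f z) \<le> B * (1 / (1 + norm z) ^ 4)"
      using assms(2)[of z] by (simp add: field_simps)
    then show "norm (f z) \<le> norm (B * (1 / (1 + norm z) ^ 4))"
      by (rule order_trans) (simp only: real_norm_def abs_ge_self)
  qed
qed (use assms in simp)

section \<open>Schwartz functions\<close>

lemma schwartz_differentiable: "schwartz f \<Longrightarrow> f differentiable (at z)"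
  unfolding schwartz_def by (metis empty_set empty_subsetI iterated_deriv.simps(1))

lemma schwartz_decay:
  assumes "schwartz f"
  obtains B where "B > 0" "\<And>z. (1 + norm z) ^ N * norm (f z) \<le> B"
proof -
  obtain B where "\<forall>z. (1 + norm z) ^ N * norm (iterated_deriv [] f z) \<le> B"
    using assms unfolding schwartz_def by (metis empty_set empty_subsetI)
  then show thesis
    using that[of "max B 1"] by (auto simp: max.coboundedI1)
qed

lemma schwartz_continuous: "schwartz f \<Longrightarrow> continuous_on A f"
  using schwartz_differentiable
  by (auto intro!: continuous_at_imp_continuous_on differentiable_imp_continuous_within)

lemma schwartz_measurable: "schwartz f \<Longrightarrow> f \<in> borel_measurable borel"
  using schwartz_continuous by (rule borel_measurable_continuous_onI)

lemma schwartz_integrable: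
  fixes f :: "real \<times> real \<Rightarrow> complex"
  assumes "schwartz f"
  shows "integrable lborel f"
  using schwartz_decay[OF assms, of 4] integrable_of_decay[OF schwartz_measurable[OF assms]] by metis

lemma iterated_deriv_append:
  "iterated_deriv (vs @ ws) f = iterated_deriv vs (iterated_deriv ws f)"
  by (induction vs) auto

text \<open>The head of a direction list is applied last, so differentiating \<open>f\<close> first
  means appending \<open>v\<close> at the end of the list.\<close>

lemma schwartz_derivative:
  assumes "schwartz f" "v \<in> Basis"
  shows "schwartz (\<lambda>z. frechet_derivative f (at z) v)"
proof -
  have "iterated_deriv vs (\<lambda>z. frechet_derivative f (at z) v) = iterated_deriv (vs @ [v]) f" for vs
    by (simp add: iterated_deriv_append)
  then show ?thesis
    using assms unfolding schwartz_def by simp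
qed

section \<open>Decay of the Fourier transform\<close>

lemma norm_fourier_kernel [simp]: "norm (exp (- \<i> * of_real t)) = 1" "norm (exp (- (\<i> * of_real t))) = 1"
  by (simp_all add: norm_exp_eq_Re)

lemma fourier_measurable:
  assumes [measurable]: "f \<in> borel_measurable borel"
  shows "fourier f \<in> borel_measurable borel"
  unfolding fourier_def[abs_def] by measurable

lemma norm_fourier_le: "norm (fourier f w) \<le> (LINT z|lborel. norm (f z))"
proof -
  have "norm (fourier f w) \<le> (LINT z|lborel. norm (exp (- \<i> * of_real (z \<bullet> w)) * f z))"
    unfolding fourier_def by (rule integral_norm_bound)
  then show ?thesis by (simp add: norm_mult)
qed

lemma fourier_kernel_integrable:
  assumes "integrable lborel f"
  shows "integrable lborel (\<lambda>z. exp (- \<i> * of_real (z \<bullet> w)) * f z)"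
  using assms by (rule Bochner_Integration.integrable_bound) (use assms in \<open>auto simp: norm_mult\<close>)

text \<open>Used with \<open>c = 1\<close> for translations, \<open>c = -1\<close> for reflections
  and positive \<open>c\<close> for the Gaussian regularisation.\<close>

lemma fourier_affine:
  fixes f :: "'a::euclidean_space \<Rightarrow> complex"
  assumes "c \<noteq> 0"
  shows "fourier f w = \<bar>c\<bar> ^ DIM('a) *\<^sub>R (exp (- \<i> * of_real (t \<bullet> w)) * fourier (\<lambda>z. f (t + c *\<^sub>R z)) (c *\<^sub>R w))"
proof -
  have "fourier f w = \<bar>c\<bar> ^ DIM('a) *\<^sub>R
      (LINT z|lborel. exp (- \<i> * of_real ((t + c *\<^sub>R z) \<bullet> w)) * f (t + c *\<^sub>R z))"
    unfolding fourier_def by (rule integral_lborel_affine[OF assms])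
  also have "(LINT z|lborel. exp (- \<i> * of_real ((t + c *\<^sub>R z) \<bullet> w)) * f (t + c *\<^sub>R z)) =
      exp (- \<i> * of_real (t \<bullet> w)) * fourier (\<lambda>z. f (t + c *\<^sub>R z)) (c *\<^sub>R w)"
    unfolding fourier_def integral_mult_right_zero[symmetric]
    by (intro Bochner_Integration.integral_cong)
      (simp_all add: inner_add_left distrib_left mult.assoc flip: exp_add)
  finally show ?thesis .
qed

lemma has_vector_derivative_imp_tendsto_quotient:
  fixes g :: "real \<Rightarrow> 'a::real_normed_vector"
  assumes "(g has_vector_derivative D) (at 0)"
  shows "((\<lambda>t. (g t - g 0) /\<^sub>R t) \<longlongrightarrow> D) (at 0)"
proof -
  have "((\<lambda>t. norm (g t - g 0 - t *\<^sub>R D) / norm t) \<longlongrightarrow> 0) (at 0)"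
    using assms by (simp add: has_vector_derivative_def has_derivative_iff_norm)
  moreover have "\<forall>\<^sub>F t in at 0. norm (g t - g 0 - t *\<^sub>R D) / norm t = norm ((g t - g 0) /\<^sub>R t - D)"
  proof (rule eventually_at_filter[THEN iffD2], intro always_eventually allI impI)
    fix t :: real assume "t \<noteq> 0"
    then have "(g t - g 0) /\<^sub>R t - D = (g t - g 0 - t *\<^sub>R D) /\<^sub>R t"
      by (simp add: scaleR_diff_right)
    then show "norm (g t - g 0 - t *\<^sub>R D) / norm t = norm ((g t - g 0) /\<^sub>R t - D)"
      by (simp add: divide_inverse mult.commute)
  qed
  ultimately have "((\<lambda>t. norm ((g t - g 0) /\<^sub>R t - D)) \<longlongrightarrow> 0) (at 0)"
    by (rule Lim_transform_eventually)
  then show ?thesis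
    by (rule Lim_null[THEN iffD2, OF tendsto_norm_zero_cancel])
qed

text \<open>Provides an integrable majorant for difference quotients. The mean value theorem leads
  to a point at distance less than 1 from \<open>z\<close>, where \<open>1 + norm\<close> has shrunk
  by a factor of at most 2; this costs \<open>2 ^ N\<close>.\<close>

lemma norm_diff_along_line_le:
  fixes f :: "'a::euclidean_space \<Rightarrow> complex"
  assumes f: "\<And>z. f differentiable (at z)" and v: "norm v = 1" and h: "0 < h" "h \<le> 1"
    and B: "\<And>z. (1 + norm z) ^ N * norm (frechet_derivative f (at z) v) \<le> B"
  shows "norm (f (z + h *\<^sub>R v) - f z) \<le> h * (2 ^ N * B / (1 + norm z) ^ N)"
proof -
  have der: "((\<lambda>t. f (z + t *\<^sub>R v)) has_derivative
      (\<lambda>s. frechet_derivative f (at (z + t *\<^sub>R v)) (s *\<^sub>R v))) (at t)" for t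
    using f[of "z + t *\<^sub>R v"] unfolding frechet_derivative_works
    by (rule has_derivative_compose[rotated]) (auto intro!: derivative_eq_intros)
  have "continuous_on {0..h} (\<lambda>t. f (z + t *\<^sub>R v))"
    using has_derivative_continuous[OF der] by (intro continuous_at_imp_continuous_on) blast
  then obtain t where t: "0 < t" "t < h"
    and le: "norm (f (z + h *\<^sub>R v) - f z) \<le> norm (frechet_derivative f (at (z + t *\<^sub>R v)) (h *\<^sub>R v))"
    using mvt_general[OF h(1) _ der] by auto
  have "norm z \<le> norm (z + t *\<^sub>R v) + t"
    using norm_triangle_ineq4[of "z + t *\<^sub>R v" "t *\<^sub>R v"] v t by simp
  then have "1 + norm z \<le> 2 * (1 + norm (z + t *\<^sub>R v))"
    using norm_ge_zero[of "z + t *\<^sub>R v"] t h by argo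
  then have "(1 + norm z) ^ N \<le> 2 ^ N * (1 + norm (z + t *\<^sub>R v)) ^ N"
    by (metis power_mono power_mult_distrib norm_ge_zero add_nonneg_nonneg zero_le_one)
  then have "(1 + norm z) ^ N * norm (frechet_derivative f (at (z + t *\<^sub>R v)) v) \<le>
      2 ^ N * ((1 + norm (z + t *\<^sub>R v)) ^ N * norm (frechet_derivative f (at (z + t *\<^sub>R v)) v))"
    by (simp add: mult_right_mono flip: mult.assoc)
  also have "\<dots> \<le> 2 ^ N * B"
    using B by (intro mult_left_mono) auto
  finally have bound: "norm (frechet_derivative f (at (z + t *\<^sub>R v)) v) \<le> 2 ^ N * B / (1 + norm z) ^ N"
    by (subst pos_le_divide_eq) (auto intro!: zero_less_power add_pos_nonneg simp: mult.commute)
  have "frechet_derivative f (at (z + t *\<^sub>R v)) (h *\<^sub>R v) =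
      h *\<^sub>R frechet_derivative f (at (z + t *\<^sub>R v)) v"
    using f by (intro linear_cmul linear_frechet_derivative)
  then have "norm (f (z + h *\<^sub>R v) - f z) \<le> h * norm (frechet_derivative f (at (z + t *\<^sub>R v)) v)"
    using le h by simp
  also have "\<dots> \<le> h * (2 ^ N * B / (1 + norm z) ^ N)"
    using bound h by (intro mult_left_mono) auto
  finally show ?thesis .
qed

text \<open>Replaces integration by parts by computing one limit twice: the transforms of the
  difference quotients converge to the left side by dominated convergence, and, because a
  translation multiplies the transform by a phase, to the right side through the derivative of that
  phase at 0.\<close>

lemma fourier_derivative:
  fixes f :: "real \<times> real \<Rightarrow> complex"
  assumes f: "schwartz f" and v: "v \<in> Basis"
  shows "fourier (\<lambda>z. frechet_derivative f (at z) v) w = \<i> * of_real (v \<bullet> w) * fourier f w"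
proof (rule LIMSEQ_unique)
  let ?h = "\<lambda>n. 1 / real (Suc n)"
  let ?d = "\<lambda>z. frechet_derivative f (at z) v"
  let ?e = "\<lambda>z. exp (- \<i> * of_real (z \<bullet> w))"
  let ?s = "\<lambda>n z. ?e z * ((f (z + ?h n *\<^sub>R v) - f z) /\<^sub>R ?h n)"
  have h0: "(\<lambda>n. ?h n) \<longlonglongrightarrow> 0"
    by (rule LIMSEQ_Suc) (rule lim_1_over_n)
  have h0': "filterlim ?h (at 0) sequentially"
    using h0 by (intro filterlim_atI) auto
  note [measurable] = schwartz_measurable[OF f] schwartz_measurable[OF schwartz_derivative[OF f v]]
  obtain B where B: "\<And>z. (1 + norm z) ^ 4 * norm (?d z) \<le> B"
    using schwartz_decay[OF schwartz_derivative[OF f v], of 4] by metis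
  show "(\<lambda>n. LINT z|lborel. ?s n z) \<longlonglongrightarrow> fourier ?d w"
    unfolding fourier_def
  proof (rule integral_dominated_convergence)
    show "integrable lborel (\<lambda>z::real \<times> real. 2 ^ 4 * B * (1 / (1 + norm z) ^ 4))"
      using integrable_inverse_power_plane by (rule integrable_mult_right)
    show "AE z in lborel. (\<lambda>n. ?s n z) \<longlonglongrightarrow> ?e z * ?d z"
    proof (intro AE_I2 tendsto_intros)
      fix z :: "real \<times> real"
      have "((\<lambda>t. f (z + t *\<^sub>R v)) has_derivative
          (\<lambda>s. frechet_derivative f (at (z + 0 *\<^sub>R v)) (s *\<^sub>R v))) (at 0)"
        using schwartz_differentiable[OF f, of "z + 0 *\<^sub>R v"] unfolding frechet_derivative_works
        by (rule has_derivative_compose[rotated]) (auto intro!: derivative_eq_intros)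
      moreover have "(\<lambda>s. frechet_derivative f (at z) (s *\<^sub>R v)) = (\<lambda>s. s *\<^sub>R ?d z)"
        using linear_cmul[OF linear_frechet_derivative[OF schwartz_differentiable[OF f, of z]]] by auto
      ultimately have "((\<lambda>t. f (z + t *\<^sub>R v)) has_vector_derivative ?d z) (at 0)"
        by (simp add: has_vector_derivative_def)
      from has_vector_derivative_imp_tendsto_quotient[OF this]
      have "((\<lambda>t. (f (z + t *\<^sub>R v) - f z) /\<^sub>R t) \<longlongrightarrow> ?d z) (at 0)"
        by simp
      then show "(\<lambda>n. (f (z + ?h n *\<^sub>R v) - f z) /\<^sub>R ?h n) \<longlonglongrightarrow> ?d z"
        using h0' by (rule filterlim_compose)
    qed
    show "AE z in lborel. norm (?s n z) \<le> 2 ^ 4 * B * (1 / (1 + norm z) ^ 4)" for n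
    proof (intro AE_I2)
      fix z :: "real \<times> real"
      have "norm (f (z + ?h n *\<^sub>R v) - f z) \<le> ?h n * (2 ^ 4 * B / (1 + norm z) ^ 4)"
        using schwartz_differentiable[OF f] B v by (intro norm_diff_along_line_le) auto
      then have "norm (f (z + ?h n *\<^sub>R v) - f z) / ?h n \<le> 2 ^ 4 * B / (1 + norm z) ^ 4"
        by (subst pos_divide_le_eq) (simp_all only: mult.commute, simp)
      moreover have "norm (?s n z) = norm (f (z + ?h n *\<^sub>R v) - f z) / ?h n"
        by (simp add: norm_mult)
      ultimately show "norm (?s n z) \<le> 2 ^ 4 * B * (1 / (1 + norm z) ^ 4)"
        by (simp only: times_divide_eq_right mult_1_right)
    qed
  qed measurable
  have eq: "(LINT z|lborel. ?s n z) = (exp (\<i> * of_real (?h n * (v \<bullet> w))) - 1) /\<^sub>R ?h n * fourier f w" for n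
  proof -
    have int: "integrable lborel (\<lambda>z. ?e z * f (z + ?h n *\<^sub>R v))" "integrable lborel (\<lambda>z. ?e z * f z)"
      using fourier_kernel_integrable[OF integrable_lborel_affine[of 1, OF _ schwartz_integrable[OF f]],
          of w "?h n *\<^sub>R v"] fourier_kernel_integrable[OF schwartz_integrable[OF f], of w]
      by (simp_all add: add.commute)
    have "(LINT z|lborel. ?s n z) = (LINT z|lborel. (?e z * f (z + ?h n *\<^sub>R v) - ?e z * f z) /\<^sub>R ?h n)"
      by (intro Bochner_Integration.integral_cong) (simp_all add: right_diff_distrib)
    also have "\<dots> = ((LINT z|lborel. ?e z * f (z + ?h n *\<^sub>R v)) - fourier f w) /\<^sub>R ?h n"
      unfolding fourier_def integral_scaleR_right Bochner_Integration.integral_diff[OF int] ..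
    also have "(LINT z|lborel. ?e z * f (z + ?h n *\<^sub>R v)) = fourier (\<lambda>z. f (?h n *\<^sub>R v + z)) w"
      unfolding fourier_def by (simp only: add.commute)
    also have "\<dots> = exp (\<i> * of_real (?h n * (v \<bullet> w))) * fourier f w"
    proof -
      have A: "fourier f w = exp (- \<i> * of_real (?h n * (v \<bullet> w))) * fourier (\<lambda>z. f (?h n *\<^sub>R v + z)) w"
        using fourier_affine[of 1 f w "?h n *\<^sub>R v"] by (simp only: inner_scaleR_left) simp
      moreover have "exp (\<i> * of_real (?h n * (v \<bullet> w))) * exp (- \<i> * of_real (?h n * (v \<bullet> w))) = 1"
        by (simp flip: exp_add)
      ultimately show ?thesis
        unfolding A mult.assoc[symmetric] by (simp only: mult_1_left)
    qed
    finally show ?thesis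
      by (simp add: left_diff_distrib)
  qed
  show "(\<lambda>n. LINT z|lborel. ?s n z) \<longlonglongrightarrow> \<i> * of_real (v \<bullet> w) * fourier f w"
    unfolding eq
  proof (intro tendsto_intros)
    have "((\<lambda>z. exp (\<i> * (z * of_real (v \<bullet> w)))) has_field_derivative \<i> * of_real (v \<bullet> w))
        (at (of_real 0))"
      by (auto intro!: derivative_eq_intros)
    from has_vector_derivative_real_field[OF this]
    have "((\<lambda>t. exp (\<i> * of_real (t * (v \<bullet> w)))) has_vector_derivative \<i> * of_real (v \<bullet> w)) (at 0)"
      by simp
    from has_vector_derivative_imp_tendsto_quotient[OF this]
    have "((\<lambda>t. (exp (\<i> * of_real (t * (v \<bullet> w))) - 1) /\<^sub>R t) \<longlongrightarrow> \<i> * of_real (v \<bullet> w)) (at 0)"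
      by simp
    then show "(\<lambda>n. (exp (\<i> * of_real (?h n * (v \<bullet> w))) - 1) /\<^sub>R ?h n) \<longlonglongrightarrow> \<i> * of_real (v \<bullet> w)"
      using h0' by (rule filterlim_compose)
  qed
qed

text \<open>Every factor \<open>v \<bullet> w\<close> is traded for a derivative of
  \<open>f\<close>, which is again Schwartz; therefore the induction varies
  \<open>f\<close>.\<close>

lemma fourier_power_bounded:
  fixes f :: "real \<times> real \<Rightarrow> complex"
  assumes "schwartz f" "v \<in> Basis"
  shows "\<exists>B. \<forall>w. \<bar>v \<bullet> w\<bar> ^ N * norm (fourier f w) \<le> B"
  using assms
proof (induction N arbitrary: f)
  case 0
  then show ?case using norm_fourier_le by auto
next
  case (Suc N)
  obtain B where "\<forall>w. \<bar>v \<bullet> w\<bar> ^ N * norm (fourier (\<lambda>z. frechet_derivative f (at z) v) w) \<le> B"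
    using Suc.IH[OF schwartz_derivative] Suc.prems by blast
  then have "\<forall>w. \<bar>v \<bullet> w\<bar> ^ Suc N * norm (fourier f w) \<le> B"
    using Suc.prems by (simp add: fourier_derivative norm_mult ac_simps)
  then show ?case ..
qed

text \<open>\<open>1 + norm w\<close> is at most three times the maximum of 1 and the two
  coordinates in absolute value, and a power of a maximum is at most the sum of the powers. So
  bounds along the two axes suffice.\<close>

lemma fourier_decay:
  fixes f :: "real \<times> real \<Rightarrow> complex"
  assumes f: "schwartz f"
  obtains B where "B > 0" "\<And>w. (1 + norm w) ^ N * norm (fourier f w) \<le> B"
proof -
  obtain B0 where B0: "\<And>w. norm (fourier f w) \<le> B0"
    using norm_fourier_le by blast
  have "(1, 0) \<in> (Basis :: (real \<times> real) set)" "(0, 1) \<in> (Basis :: (real \<times> real) set)"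
    by (simp_all add: Basis_prod_def)
  then obtain B1 B2 where B1: "\<And>w. \<bar>(1, 0) \<bullet> w\<bar> ^ N * norm (fourier f w) \<le> B1"
    and B2: "\<And>w. \<bar>(0, 1) \<bullet> w\<bar> ^ N * norm (fourier f w) \<le> B2"
    using fourier_power_bounded[OF f] by meson
  have "(1 + norm w) ^ N * norm (fourier f w) \<le> 3 ^ N * (B0 + B1 + B2)" for w
  proof -
    obtain x y where w: "w = (x, y)" by force
    define m where "m = max 1 (max \<bar>x\<bar> \<bar>y\<bar>)"
    have "norm w \<le> \<bar>x\<bar> + \<bar>y\<bar>"
      using norm_Pair_le[of x y] by (simp add: w)
    then have "1 + norm w \<le> 3 * m" by (simp add: m_def)
    then have "(1 + norm w) ^ N \<le> (3 * m) ^ N"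
      by (intro power_mono) auto
    also have "(3 * m) ^ N \<le> 3 ^ N * (1 + \<bar>x\<bar> ^ N + \<bar>y\<bar> ^ N)"
      unfolding power_mult_distrib by (intro mult_left_mono) (auto simp: m_def max_def)
    finally have "(1 + norm w) ^ N * norm (fourier f w) \<le>
        3 ^ N * (1 + \<bar>x\<bar> ^ N + \<bar>y\<bar> ^ N) * norm (fourier f w)"
      by (intro mult_right_mono) auto
    also have "\<dots> = 3 ^ N * (norm (fourier f w) + \<bar>x\<bar> ^ N * norm (fourier f w) + \<bar>y\<bar> ^ N * norm (fourier f w))"
      by (simp add: algebra_simps)
    also have "\<dots> \<le> 3 ^ N * (B0 + B1 + B2)"
      using B0[of w] B1[of w] B2[of w] by (intro mult_left_mono add_mono) (auto simp: w)
    finally show ?thesis .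
  qed
  then show thesis
    using that[of "max 1 (3 ^ N * (B0 + B1 + B2))"] by (auto simp: max.coboundedI2)
qed

lemma fourier_integrable:
  fixes f :: "real \<times> real \<Rightarrow> complex"
  assumes f: "schwartz f"
  shows "integrable lborel (fourier f)"
proof -
  obtain B where "\<And>w. (1 + norm w) ^ 4 * norm (fourier f w) \<le> B"
    using fourier_decay[OF f, of 4] by blast
  then show ?thesis
    by (rule integrable_of_decay[OF fourier_measurable[OF schwartz_measurable[OF f]]])
qed

text \<open>The kernel is symmetric and of modulus 1, so Fubini applies to the integrable product
  \<open>f x * g y\<close>.\<close>

lemma fourier_multiplication:
  fixes f g :: "'a::euclidean_space \<Rightarrow> complex"
  assumes f: "integrable lborel f" and g: "integrable lborel g"
  shows "(LINT z|lborel. fourier f z * g z) = (LINT z|lborel. f z * fourier g z)"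
proof -
  have [measurable]: "f \<in> borel_measurable borel" "g \<in> borel_measurable borel"
    using f g by (auto dest: borel_measurable_integrable)
  let ?F = "\<lambda>x y. exp (- \<i> * of_real (x \<bullet> y)) * (f x * g y)"
  have "integrable (lborel \<Otimes>\<^sub>M lborel) (case_prod ?F)"
  proof (rule lborel_pair.Fubini_integrable)
    show "integrable lborel (\<lambda>x. LINT y|lborel. norm (case_prod ?F (x, y)))"
      using f by (simp add: norm_mult)
    show "AE x in lborel. integrable lborel (\<lambda>y. case_prod ?F (x, y))"
    proof (intro AE_I2)
      fix x
      have "integrable lborel (\<lambda>y. f x * (exp (- \<i> * of_real (y \<bullet> x)) * g y))"
        by (intro integrable_mult_right fourier_kernel_integrable g)
      then show "integrable lborel (\<lambda>y. case_prod ?F (x, y))"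
        by (simp add: inner_commute ac_simps)
    qed
  qed measurable
  from lborel_pair.Fubini_integral[OF this]
  have "(LINT y|lborel. LINT x|lborel. ?F x y) = (LINT x|lborel. LINT y|lborel. ?F x y)" .
  moreover have "(LINT x|lborel. ?F x y) = fourier f y * g y" for y
    by (simp add: fourier_def mult.assoc flip: integral_mult_left_zero)
  moreover have "(LINT y|lborel. ?F x y) = f x * fourier g x" for x
    by (simp add: fourier_def inner_commute ac_simps flip: integral_mult_right_zero)
  ultimately show ?thesis by simp
qed

section \<open>Gaussians and Fourier inversion\<close>

definition gaussian :: "real \<times> real \<Rightarrow> real" where
  "gaussian z = exp (- (norm z)\<^sup>2 / 2)"

lemma gaussian_eq:
  "gaussian z = 2 * pi * (std_normal_density (fst z) * std_normal_density (snd z))"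
proof -
  have "(sqrt 2 * sqrt pi) * (sqrt 2 * sqrt pi) = 2 * pi"
    by (simp add: algebra_simps)
  then show ?thesis
    by (cases z)
      (simp add: gaussian_def norm_Pair std_normal_density_def real_sqrt_mult add_divide_distrib
        diff_divide_distrib flip: exp_add)
qed

lemma gaussian_integrable: "integrable lborel gaussian"
proof -
  have "integrable (lborel \<Otimes>\<^sub>M lborel) (\<lambda>(x, y). std_normal_density x * std_normal_density y)"
    by (rule lborel_pair.Fubini_integrable) simp_all
  then show ?thesis
    unfolding gaussian_eq[abs_def] by (simp add: split_beta' lborel_prod)
qed

lemma fourier_gaussian: "fourier (\<lambda>z. of_real (gaussian z)) w = 2 * pi * gaussian w"
proof -
  obtain s t where w: "w = (s, t)" by force
  let ?n = std_normal_density
  \<comment> \<open>This is the characteristic function of the standard normal law; the opposite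
    sign in its exponent is the reason for evaluating it at \<open>- s\<close>.\<close>
  have char: "(LINT x|lborel. exp (- \<i> * of_real (x * s)) * of_real (?n x)) = of_real (exp (- s\<^sup>2 / 2))" for s
  proof -
    have "char std_normal_distribution (- s) = (LINT x|lborel. ?n x *\<^sub>R exp (\<i> * of_real (- s * x)))"
      unfolding char_def by (subst integral_density) auto
    then show ?thesis
      by (simp add: char_std_normal_distribution scaleR_conv_of_real ac_simps)
  qed
  let ?F = "\<lambda>x y. (exp (- \<i> * of_real (x * s)) * of_real (?n x)) * (exp (- \<i> * of_real (y * t)) * of_real (?n y))"
  have int: "integrable lborel (\<lambda>x. exp (- \<i> * of_real (x * s)) * complex_of_real (?n x))" for s
    using fourier_kernel_integrable[of "\<lambda>x. complex_of_real (?n x)" s] by simp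
  have "integrable (lborel \<Otimes>\<^sub>M lborel) (case_prod ?F)"
    by (rule lborel_pair.Fubini_integrable) (use int in \<open>simp_all add: norm_mult\<close>)
  from lborel_pair.integral_fst[OF this]
  have "(LINT z|lborel. case_prod ?F z) = (LINT x|lborel. LINT y|lborel. ?F x y)"
    by (simp only: lborel_prod)
  also have "\<dots> = of_real (exp (- s\<^sup>2 / 2)) * of_real (exp (- t\<^sup>2 / 2))"
    by (simp only: integral_mult_right_zero integral_mult_left_zero char)
  finally have "(LINT z|lborel. case_prod ?F z) = of_real (gaussian w)"
    by (simp add: w gaussian_def norm_Pair add_divide_distrib diff_divide_distrib flip: of_real_mult exp_add)
  moreover have "fourier (\<lambda>z. of_real (gaussian z)) w = (LINT z|lborel. 2 * pi * case_prod ?F z)"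
    unfolding fourier_def
    by (intro Bochner_Integration.integral_cong)
      (auto simp: gaussian_eq w distrib_left mult.commute mult.left_commute simp flip: exp_add)
  ultimately show ?thesis
    by simp
qed

lemma schwartz_bounded:
  assumes "schwartz f"
  shows "\<exists>B. \<forall>z. norm (f z) \<le> B"
proof -
  obtain B where "\<And>z. (1 + norm z) ^ 0 * norm (f z) \<le> B"
    using schwartz_decay[OF assms] by blast
  then show ?thesis by auto
qed

lemma integral_gaussian: "(LINT z|lborel. complex_of_real (gaussian z)) = 2 * pi"
  using fourier_gaussian[of 0] by (simp add: fourier_def gaussian_def)

lemma gaussian_le_1: "\<bar>gaussian z\<bar> \<le> 1"
  by (simp add: gaussian_def)

lemma gaussian_measurable [measurable]: "gaussian \<in> borel_measurable borel"
  unfolding gaussian_def[abs_def] by measurable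

text \<open>The phase and the dilation are absorbed into a translated and rescaled copy of
  \<open>f\<close>. The multiplication formula then moves the transform onto the Gaussian, which
  leaves an average of \<open>f\<close> near \<open>z\<close> of total mass
  \<open>(2 * pi)\<^sup>2\<close>.\<close>

lemma gaussian_regularised_inversion:
  fixes f :: "real \<times> real \<Rightarrow> complex"
  assumes f: "integrable lborel f" and \<epsilon>: "\<epsilon> > 0"
  shows "(LINT w|lborel. exp (\<i> * of_real (z \<bullet> w)) * fourier f w * of_real (gaussian (\<epsilon> *\<^sub>R w))) =
    (LINT x|lborel. f (z + \<epsilon> *\<^sub>R x) * (2 * pi * gaussian x))"
proof -
  let ?f = "\<lambda>x. f (z + \<epsilon> *\<^sub>R x)"
  have kernel: "exp (\<i> * of_real (z \<bullet> w)) * fourier f w = \<epsilon>\<^sup>2 *\<^sub>R fourier ?f (\<epsilon> *\<^sub>R w)" for w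
  proof -
    have A: "fourier f w = \<epsilon>\<^sup>2 *\<^sub>R (exp (- \<i> * of_real (z \<bullet> w)) * fourier ?f (\<epsilon> *\<^sub>R w))"
      using fourier_affine[of \<epsilon> f w z] \<epsilon> by (simp add: power2_eq_square)
    have "exp (\<i> * of_real (z \<bullet> w)) * exp (- \<i> * of_real (z \<bullet> w)) = 1"
      by (simp flip: exp_add)
    then show ?thesis
      unfolding A mult_scaleR_right mult.assoc[symmetric] by (simp only: mult_1_left)
  qed
  have "(LINT w|lborel. exp (\<i> * of_real (z \<bullet> w)) * fourier f w * of_real (gaussian (\<epsilon> *\<^sub>R w))) =
      (LINT w|lborel. \<epsilon>\<^sup>2 *\<^sub>R (fourier ?f (\<epsilon> *\<^sub>R w) * of_real (gaussian (\<epsilon> *\<^sub>R w))))"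
    by (simp only: kernel mult_scaleR_left)
  also have "\<dots> = (LINT u|lborel. fourier ?f u * of_real (gaussian u))"
    using integral_lborel_affine[of \<epsilon> "\<lambda>u. fourier ?f u * of_real (gaussian u)" 0] \<epsilon>
    by (simp add: power2_eq_square)
  also have "\<dots> = (LINT x|lborel. ?f x * fourier (\<lambda>z. of_real (gaussian z)) x)"
    using \<epsilon> gaussian_integrable by (intro fourier_multiplication integrable_lborel_affine f) auto
  also have "\<dots> = (LINT x|lborel. ?f x * (2 * pi * gaussian x))"
    by (simp only: fourier_gaussian)
  finally show ?thesis .
qed

text \<open>Removes the regularisation along \<open>\<epsilon> = 1 / Suc n\<close>. The frequency
  side is dominated by the integrable \<open>norm (fourier f w)\<close>, the space side by a bound
  of \<open>f\<close> times the Gaussian.\<close>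

lemma fourier_inversion:
  fixes f :: "real \<times> real \<Rightarrow> complex"
  assumes f: "schwartz f"
  shows "(LINT w|lborel. exp (\<i> * of_real (z \<bullet> w)) * fourier f w) = (2 * pi)\<^sup>2 * f z"
proof (rule LIMSEQ_unique)
  let ?h = "\<lambda>n. 1 / real (Suc n)"
  have h0: "(\<lambda>n. ?h n) \<longlonglongrightarrow> 0"
    by (rule LIMSEQ_Suc) (rule lim_1_over_n)
  note [measurable] = schwartz_measurable[OF f] fourier_measurable[OF schwartz_measurable[OF f]]
  obtain B where B: "\<And>z. norm (f z) \<le> B"
    using schwartz_bounded[OF f] by blast
  let ?L = "\<lambda>n. LINT w|lborel. exp (\<i> * of_real (z \<bullet> w)) * fourier f w * of_real (gaussian (?h n *\<^sub>R w))"
  show "?L \<longlonglongrightarrow> (LINT w|lborel. exp (\<i> * of_real (z \<bullet> w)) * fourier f w)"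
  proof (rule integral_dominated_convergence)
    show "integrable lborel (\<lambda>w. norm (fourier f w))"
      using fourier_integrable[OF f] by (rule integrable_norm)
    show "AE w in lborel. (\<lambda>n. exp (\<i> * of_real (z \<bullet> w)) * fourier f w * of_real (gaussian (?h n *\<^sub>R w)))
        \<longlonglongrightarrow> exp (\<i> * of_real (z \<bullet> w)) * fourier f w"
    proof (intro AE_I2)
      fix w :: "real \<times> real"
      have "(\<lambda>n. exp (\<i> * of_real (z \<bullet> w)) * fourier f w * of_real (gaussian (?h n *\<^sub>R w)))
          \<longlonglongrightarrow> exp (\<i> * of_real (z \<bullet> w)) * fourier f w * of_real (gaussian (0 *\<^sub>R w))"
        unfolding gaussian_def by (intro tendsto_intros h0) simp
      then show "(\<lambda>n. exp (\<i> * of_real (z \<bullet> w)) * fourier f w * of_real (gaussian (?h n *\<^sub>R w)))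
          \<longlonglongrightarrow> exp (\<i> * of_real (z \<bullet> w)) * fourier f w"
        by (simp add: gaussian_def)
    qed
    show "AE w in lborel. norm (exp (\<i> * of_real (z \<bullet> w)) * fourier f w * of_real (gaussian (?h n *\<^sub>R w)))
        \<le> norm (fourier f w)" for n
      using gaussian_le_1 by (intro AE_I2) (simp add: norm_mult mult_left_le)
  qed measurable
  have L: "?L n = (LINT x|lborel. f (z + ?h n *\<^sub>R x) * (2 * pi * gaussian x))" for n
    by (intro gaussian_regularised_inversion schwartz_integrable f) simp
  have "?L \<longlonglongrightarrow> (LINT x|lborel. f z * (2 * pi * gaussian x))"
    unfolding L
  proof (rule integral_dominated_convergence)
    show "integrable lborel (\<lambda>x. B * (2 * pi * gaussian x))"
      using gaussian_integrable by simp
    show "AE x in lborel. (\<lambda>n. f (z + ?h n *\<^sub>R x) * (2 * pi * gaussian x)) \<longlonglongrightarrow> f z * (2 * pi * gaussian x)"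
    proof (intro AE_I2 tendsto_intros)
      fix x :: "real \<times> real"
      have "(\<lambda>n. z + ?h n *\<^sub>R x) \<longlonglongrightarrow> z + 0 *\<^sub>R x"
        by (intro tendsto_intros h0)
      then have lim: "(\<lambda>n. z + ?h n *\<^sub>R x) \<longlonglongrightarrow> z" by simp
      have "isCont f z"
        by (rule differentiable_imp_continuous_within[OF schwartz_differentiable[OF f]])
      then show "(\<lambda>n. f (z + ?h n *\<^sub>R x)) \<longlonglongrightarrow> f z"
        by (rule isCont_tendsto_compose[OF _ lim])
    qed
    show "AE x in lborel. norm (f (z + ?h n *\<^sub>R x) * (2 * pi * gaussian x)) \<le> B * (2 * pi * gaussian x)" for n
      using B by (intro AE_I2) (simp add: norm_mult mult_right_mono gaussian_def)
  qed measurable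
  also have "(LINT x|lborel. f z * (2 * pi * gaussian x)) = (2 * pi)\<^sup>2 * f z"
    using integral_gaussian by (simp add: power2_eq_square)
  finally show "?L \<longlonglongrightarrow> (2 * pi)\<^sup>2 * f z" .
qed

text \<open>Obtained from the multiplication formula for \<open>fourier f\<close> and the reflected
  \<open>g\<close>. Asking only integrability of \<open>g\<close> allows products and modulations of
  Schwartz functions in its place, without showing that these are Schwartz.\<close>

lemma fourier_inversion_integral:
  fixes f g :: "real \<times> real \<Rightarrow> complex"
  assumes f: "schwartz f" and g: "integrable lborel g"
  shows "(2 * pi)\<^sup>2 * (LINT z|lborel. f z * g z) = (LINT w|lborel. fourier f w * fourier g (- w))"
proof -
  have [measurable]: "g \<in> borel_measurable borel"
    using g by (auto dest: borel_measurable_integrable)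
  have "fourier (fourier f) z = (2 * pi)\<^sup>2 * f (- z)" for z
    using fourier_inversion[OF f, of "- z"] by (simp add: fourier_def inner_commute)
  then have "(LINT z|lborel. (2 * pi)\<^sup>2 * f (- z) * g (- z)) = (LINT z|lborel. fourier (fourier f) z * g (- z))"
    by simp
  also have "\<dots> = (LINT w|lborel. fourier f w * fourier (\<lambda>z. g (- z)) w)"
    using fourier_integrable[OF f] integrable_lborel_affine[OF _ g, of "-1" 0]
    by (intro fourier_multiplication) auto
  also have "\<dots> = (LINT w|lborel. fourier f w * fourier g (- w))"
    using fourier_affine[of "-1" g "- w" 0 for w] by simp
  also have "(LINT z|lborel. (2 * pi)\<^sup>2 * f (- z) * g (- z)) = (2 * pi)\<^sup>2 * (LINT z|lborel. f z * g z)"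
    using integral_lborel_affine[of "-1" "\<lambda>z. f z * g z" 0] by (simp add: mult.assoc)
  finally show ?thesis .
qed

text \<open>Inversion is applied twice: to \<open>f\<close> against \<open>g * h\<close>, and, for
  each fixed frequency, to \<open>g\<close> against a modulated \<open>h\<close>.\<close>

lemma triple_product_le:
  fixes f g h :: "real \<times> real \<Rightarrow> complex"
  assumes f: "schwartz f" and g: "schwartz g" and h: "schwartz h"
  shows "ennreal (norm (LINT z|lborel. f z * g z * h z)) \<le>
    trilinear (\<lambda>w. norm (fourier f w)) (\<lambda>w. norm (fourier g w)) (\<lambda>w. norm (fourier h w)) (\<lambda>x y. 1)"
proof -
  note [measurable] = schwartz_measurable[OF f] schwartz_measurable[OF g] schwartz_measurable[OF h]
    fourier_measurable[OF schwartz_measurable[OF f]] fourier_measurable[OF schwartz_measurable[OF g]]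
    fourier_measurable[OF schwartz_measurable[OF h]]
  have mult: "integrable lborel (\<lambda>z. u z * v z)"
    if u: "schwartz u" and v: "integrable lborel v" for u v :: "real \<times> real \<Rightarrow> complex"
  proof -
    obtain B where B: "\<And>z. norm (u z) \<le> B" using schwartz_bounded[OF u] by blast
    note [measurable] = schwartz_measurable[OF u]
    have [measurable]: "v \<in> borel_measurable borel"
      using v by (auto dest: borel_measurable_integrable)
    show ?thesis
    proof (rule Bochner_Integration.integrable_bound)
      show "integrable lborel (\<lambda>z. B * norm (v z))" using v by simp
      show "AE z in lborel. norm (u z * v z) \<le> norm (B * norm (v z))"
      proof (intro AE_I2)
        fix z
        have "norm (u z * v z) \<le> B * norm (v z)"
          unfolding norm_mult by (intro mult_right_mono B) simp
        then show "norm (u z * v z) \<le> norm (B * norm (v z))"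
          by (rule order_trans) (simp only: real_norm_def abs_ge_self)
      qed
    qed measurable
  qed
  \<comment> \<open>Both inversions produce the factor \<open>(2 * pi)\<^sup>2\<close> on the
    favourable side, so it is simply dropped.\<close>
  have "1 \<le> (2 * pi)\<^sup>2"
    using pi_gt3 by (intro one_le_power) simp
  then have le: "ennreal (norm F) \<le> ennreal (norm ((2 * pi)\<^sup>2 * F))" for F :: complex
    by (intro ennreal_leI) (simp add: norm_mult norm_power mult_le_cancel_right1)
  have inner: "ennreal (norm (fourier (\<lambda>z. g z * h z) (- x))) \<le>
      (\<integral>\<^sup>+y. ennreal (norm (fourier g y)) * ennreal (norm (fourier h (- x - y))) \<partial>lborel)" for x
  proof -
    \<comment> \<open>Moving the phase into \<open>h\<close> shifts the frequency variable of its
      transform, which produces the argument \<open>- x - y\<close>.\<close>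
    let ?k = "\<lambda>z. exp (- \<i> * of_real (z \<bullet> - x)) * h z"
    have k: "integrable lborel ?k"
      by (intro fourier_kernel_integrable schwartz_integrable h)
    have k_eq: "(\<lambda>y. fourier ?k (- y)) = (\<lambda>y. fourier h (- x - y))"
    proof
      fix y
      have "- \<i> * complex_of_real (z \<bullet> - y) + - \<i> * complex_of_real (z \<bullet> - x) =
          - \<i> * complex_of_real (z \<bullet> (- x - y))" for z
        by (simp add: inner_diff_right right_diff_distrib)
      then have "exp (- \<i> * complex_of_real (z \<bullet> - y)) * ?k z =
          exp (- \<i> * complex_of_real (z \<bullet> (- x - y))) * h z" for z
        by (simp only: mult.assoc[symmetric] exp_add[symmetric])
      then show "fourier ?k (- y) = fourier h (- x - y)"
        by (simp only: fourier_def)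
    qed
    have "fourier (\<lambda>z. g z * h z) (- x) = (LINT z|lborel. g z * ?k z)"
      unfolding fourier_def by (simp only: ac_simps)
    then have "ennreal (norm (fourier (\<lambda>z. g z * h z) (- x))) \<le>
        ennreal (norm ((2 * pi)\<^sup>2 * (LINT z|lborel. g z * ?k z)))"
      using le by simp
    also have "\<dots> = ennreal (norm (LINT y|lborel. fourier g y * fourier h (- x - y)))"
      unfolding fourier_inversion_integral[OF g k] using fun_cong[OF k_eq] by simp
    also have "\<dots> \<le> (\<integral>\<^sup>+y. ennreal (norm (fourier g y)) * ennreal (norm (fourier h (- x - y))) \<partial>lborel)"
      using ennreal_norm_integral_le[of lborel "\<lambda>y. fourier g y * fourier h (- x - y)"]
      by (simp add: norm_mult ennreal_mult)
    finally show ?thesis .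
  qed
  have "ennreal (norm (LINT z|lborel. f z * (g z * h z))) \<le> ennreal (norm ((2 * pi)\<^sup>2 * (LINT z|lborel. f z * (g z * h z))))"
    by (rule le)
  also have "\<dots> = ennreal (norm (LINT x|lborel. fourier f x * fourier (\<lambda>z. g z * h z) (- x)))"
    by (subst fourier_inversion_integral[OF f]) (intro mult g schwartz_integrable h, rule refl)
  also have "\<dots> \<le> (\<integral>\<^sup>+x. ennreal (norm (fourier f x)) * ennreal (norm (fourier (\<lambda>z. g z * h z) (- x))) \<partial>lborel)"
    using ennreal_norm_integral_le[of lborel "\<lambda>x. fourier f x * fourier (\<lambda>z. g z * h z) (- x)"]
    by (simp add: norm_mult ennreal_mult)
  also have "\<dots> \<le> (\<integral>\<^sup>+x. ennreal (norm (fourier f x)) *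
      (\<integral>\<^sup>+y. ennreal (norm (fourier g y)) * ennreal (norm (fourier h (- x - y))) \<partial>lborel) \<partial>lborel)"
    by (intro nn_integral_mono mult_left_mono inner) auto
  also have "\<dots> = trilinear (\<lambda>w. norm (fourier f w)) (\<lambda>w. norm (fourier g w)) (\<lambda>w. norm (fourier h w)) (\<lambda>x y. 1)"
    unfolding trilinear_def by (simp add: nn_integral_cmult mult.assoc)
  finally show ?thesis
    by (simp add: mult.assoc)
qed

section \<open>The trilinear estimate\<close>

lemma bracket_minus [simp]: "bracket (- x) = bracket x"
  by (simp add: bracket_def)

lemma bracket_abs [simp]: "bracket \<bar>x\<bar> = bracket x"
  by (simp add: bracket_def)

lemma bracket_mono: "\<bar>x\<bar> \<le> \<bar>y\<bar> \<Longrightarrow> bracket x \<le> bracket y"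
  unfolding bracket_def by (simp add: abs_le_square_iff)

lemma bracket_add_le: "bracket (x + y) \<le> bracket x + bracket y"
proof -
  have "\<bar>x\<bar> * \<bar>y\<bar> \<le> bracket x * bracket y"
    by (intro mult_mono) (simp_all add: bracket_def less_imp_le real_le_rsqrt)
  moreover have "x * y \<le> \<bar>x\<bar> * \<bar>y\<bar>"
    by (simp flip: abs_mult)
  moreover have "(bracket x)\<^sup>2 = 1 + x\<^sup>2" "(bracket y)\<^sup>2 = 1 + y\<^sup>2"
    by (simp_all add: bracket_def)
  ultimately have "1 + (x + y)\<^sup>2 \<le> (bracket x + bracket y)\<^sup>2"
    by (simp add: power2_sum)
  then show ?thesis
    unfolding bracket_def[of "x + y"] by (intro real_le_lsqrt) (simp_all add: less_imp_le add_nonneg_nonneg)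
qed

definition pair_weight :: "real \<Rightarrow> (real \<times> real \<Rightarrow> real \<times> real \<Rightarrow> real) \<Rightarrow> (real \<times> real \<Rightarrow> real \<times> real \<Rightarrow> real) \<Rightarrow>
    real \<times> real \<Rightarrow> real \<times> real \<Rightarrow> ennreal" where
  "pair_weight a P Q x y = ennreal (bracket (P x y) powr - a * bracket (Q x y) powr - a)"

text \<open>One constant for all pairs: every determinant met below has modulus 1 or 2, so the
  square of the one-dimensional integral is a common bound.\<close>

definition pair_weight_const :: "real \<Rightarrow> ennreal" where
  "pair_weight_const a = (\<integral>\<^sup>+t. bracket t powr - (2 * a) \<partial>lborel)\<^sup>2"

lemma pair_weight_const_finite: "a > 1 / 2 \<Longrightarrow> pair_weight_const a < \<infinity>"
  unfolding pair_weight_const_def using nn_integral_bracket_powr_finite[of "2 * a"]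
  by (simp add: power2_eq_square ennreal_mult_less_top)

text \<open>Brackets are even, so the forms matter only up to sign; this permits the coefficient of
  \<open>fst x\<close> in the first form to be normalised to 1.\<close>

lemma nn_integral_pair_weight_le:
  assumes "\<And>x. \<bar>p x\<bar> = \<bar>fst x + \<alpha> * snd x + c\<bar>" "\<And>x. \<bar>q x\<bar> = \<bar>\<kappa> * fst x + \<beta> * snd x + d\<bar>"
    and "\<bar>\<beta> - \<kappa> * \<alpha>\<bar> \<ge> 1"
  shows "(\<integral>\<^sup>+x. (ennreal (bracket (p x) powr - a * bracket (q x) powr - a))\<^sup>2 \<partial>lborel) \<le> pair_weight_const a"
proof -
  let ?G = "\<lambda>t. ennreal (bracket t powr - (2 * a))"
  have p: "bracket (p x) = bracket (fst x + \<alpha> * snd x + c)" for x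
    using assms(1)[of x] by (metis bracket_abs)
  have q: "bracket (q x) = bracket (\<kappa> * fst x + \<beta> * snd x + d)" for x
    using assms(2)[of x] by (metis bracket_abs)
  have "(bracket t powr - a)\<^sup>2 = bracket t powr - (2 * a)" for t
    by (simp add: power2_eq_square flip: powr_add)
  then have sq: "(ennreal (bracket s powr - a * bracket t powr - a))\<^sup>2 = ?G s * ?G t" for s t
    by (simp only: ennreal_power mult_nonneg_nonneg powr_ge_zero power_mult_distrib ennreal_mult)
  show ?thesis
    unfolding sq p q pair_weight_const_def by (rule nn_integral_affine_pair_le) (use assms(3) in auto)
qed

text \<open>The fixed frequency enters the forms only through the offsets \<open>c y\<close> and
  \<open>d y\<close>, and translations do not affect the bound. The two following variants fix the
  first and the third frequency instead.\<close>

lemma schur_bound_pair_weight1: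
  assumes "\<And>x y. \<bar>P x y\<bar> = \<bar>fst x + \<alpha> * snd x + c y\<bar>" "\<And>x y. \<bar>Q x y\<bar> = \<bar>\<kappa> * fst x + \<beta> * snd x + d y\<bar>"
    and "\<bar>\<beta> - \<kappa> * \<alpha>\<bar> \<ge> 1"
    and [measurable]: "case_prod P \<in> borel_measurable (lborel \<Otimes>\<^sub>M lborel)"
      "case_prod Q \<in> borel_measurable (lborel \<Otimes>\<^sub>M lborel)"
  shows "schur_bound (pair_weight_const a) (pair_weight a P Q)"
proof -
  have "(\<integral>\<^sup>+x. (pair_weight a P Q x y)\<^sup>2 \<partial>lborel) \<le> pair_weight_const a" for y
    unfolding pair_weight_def using assms(1-3) by (rule nn_integral_pair_weight_le)
  then show ?thesis unfolding schur_bound_def pair_weight_def[abs_def] by auto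
qed

lemma schur_bound_pair_weight2:
  assumes "\<And>x y. \<bar>P x y\<bar> = \<bar>fst y + \<alpha> * snd y + c x\<bar>" "\<And>x y. \<bar>Q x y\<bar> = \<bar>\<kappa> * fst y + \<beta> * snd y + d x\<bar>"
    and "\<bar>\<beta> - \<kappa> * \<alpha>\<bar> \<ge> 1"
    and [measurable]: "case_prod P \<in> borel_measurable (lborel \<Otimes>\<^sub>M lborel)"
      "case_prod Q \<in> borel_measurable (lborel \<Otimes>\<^sub>M lborel)"
  shows "schur_bound (pair_weight_const a) (pair_weight a P Q)"
proof -
  have "(\<integral>\<^sup>+y. (pair_weight a P Q x y)\<^sup>2 \<partial>lborel) \<le> pair_weight_const a" for x
    unfolding pair_weight_def using assms(1-3) by (rule nn_integral_pair_weight_le)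
  then show ?thesis unfolding schur_bound_def pair_weight_def[abs_def] by auto
qed

lemma schur_bound_pair_weight3:
  assumes "\<And>x z. \<bar>P x (- z - x)\<bar> = \<bar>fst x + \<alpha> * snd x + c z\<bar>"
    "\<And>x z. \<bar>Q x (- z - x)\<bar> = \<bar>\<kappa> * fst x + \<beta> * snd x + d z\<bar>"
    and "\<bar>\<beta> - \<kappa> * \<alpha>\<bar> \<ge> 1"
    and [measurable]: "case_prod P \<in> borel_measurable (lborel \<Otimes>\<^sub>M lborel)"
      "case_prod Q \<in> borel_measurable (lborel \<Otimes>\<^sub>M lborel)"
  shows "schur_bound (pair_weight_const a) (pair_weight a P Q)"
proof -
  have "(\<integral>\<^sup>+x. (pair_weight a P Q x (- z - x))\<^sup>2 \<partial>lborel) \<le> pair_weight_const a" for z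
    unfolding pair_weight_def using assms(1-3) by (rule nn_integral_pair_weight_le)
  then show ?thesis unfolding schur_bound_def pair_weight_def[abs_def] by auto
qed

text \<open>
  The three frequencies are \<open>x\<close>, \<open>y\<close> and \<open>- x - y\<close>; the index of a linear form says which one it
  depends on.
\<close>

definition u1 :: "real \<times> real \<Rightarrow> real \<times> real \<Rightarrow> real" where "u1 x y = fst x + snd x"
definition v2 :: "real \<times> real \<Rightarrow> real \<times> real \<Rightarrow> real" where "v2 x y = fst y - snd y"
definition u3 :: "real \<times> real \<Rightarrow> real \<times> real \<Rightarrow> real" where "u3 x y = fst (- x - y) + snd (- x - y)"
definition v3 :: "real \<times> real \<Rightarrow> real \<times> real \<Rightarrow> real" where "v3 x y = fst (- x - y) - snd (- x - y)"
definition \<xi>1 :: "real \<times> real \<Rightarrow> real \<times> real \<Rightarrow> real" where "\<xi>1 x y = snd x"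
definition \<xi>2 :: "real \<times> real \<Rightarrow> real \<times> real \<Rightarrow> real" where "\<xi>2 x y = snd y"
definition \<xi>3 :: "real \<times> real \<Rightarrow> real \<times> real \<Rightarrow> real" where "\<xi>3 x y = snd (- x - y)"

lemmas linear_form_defs = u1_def v2_def u3_def v3_def \<xi>1_def \<xi>2_def \<xi>3_def

text \<open>The pairs \<open>(u1, u3)\<close> and \<open>(v2, v3)\<close> are left out: fixing a
  frequency makes one member constant or the two members parallel.\<close>

definition transversal_pairs :: "((real \<times> real \<Rightarrow> real \<times> real \<Rightarrow> real) \<times> (real \<times> real \<Rightarrow> real \<times> real \<Rightarrow> real)) list" where
  "transversal_pairs = [(u1, v2), (u1, v3), (v2, u3), (u1, \<xi>1), (u1, \<xi>2), (u1, \<xi>3), (v2, \<xi>1), (v2, \<xi>2), (v2, \<xi>3),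
     (u3, \<xi>1), (u3, \<xi>2), (u3, \<xi>3), (v3, \<xi>1), (v3, \<xi>2), (v3, \<xi>3)]"

lemma linear_form_measurable [measurable]:
  "case_prod u1 \<in> borel_measurable (lborel \<Otimes>\<^sub>M lborel)"
  "case_prod v2 \<in> borel_measurable (lborel \<Otimes>\<^sub>M lborel)"
  "case_prod u3 \<in> borel_measurable (lborel \<Otimes>\<^sub>M lborel)"
  "case_prod v3 \<in> borel_measurable (lborel \<Otimes>\<^sub>M lborel)"
  "case_prod \<xi>1 \<in> borel_measurable (lborel \<Otimes>\<^sub>M lborel)"
  "case_prod \<xi>2 \<in> borel_measurable (lborel \<Otimes>\<^sub>M lborel)"
  "case_prod \<xi>3 \<in> borel_measurable (lborel \<Otimes>\<^sub>M lborel)"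
  unfolding linear_form_defs lborel_prod case_prod_beta'
  by (simp_all only: measurable_lborel2) (intro borel_measurable_continuous_onI continuous_intros)+

text \<open>For forms in two different frequencies the remaining frequency is fixed; for two forms
  in the same frequency, one of the others. The determinant is 2 in modulus for two null forms and 1
  for a null form with a spatial frequency.\<close>

lemma schur_bound_transversal:
  assumes "(P, Q) \<in> set transversal_pairs"
  shows "schur_bound (pair_weight_const a) (pair_weight a P Q)"
proof -
  let ?s = "schur_bound (pair_weight_const a)"
  have "?s (pair_weight a u1 v2)"
    by (rule schur_bound_pair_weight3[where \<alpha> = 1 and c = "\<lambda>z. 0" and \<kappa> = 1 and \<beta> = "-1" and d = "\<lambda>z. fst z - snd z"])
      (auto simp: linear_form_defs abs_if)
  moreover have "?s (pair_weight a u1 v3)"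
    by (rule schur_bound_pair_weight1[where \<alpha> = 1 and c = "\<lambda>z. 0" and \<kappa> = 1 and \<beta> = "-1" and d = "\<lambda>z. fst z - snd z"])
      (auto simp: linear_form_defs abs_if)
  moreover have "?s (pair_weight a v2 u3)"
    by (rule schur_bound_pair_weight2[where \<alpha> = "-1" and c = "\<lambda>z. 0" and \<kappa> = 1 and \<beta> = 1 and d = "\<lambda>z. fst z + snd z"])
      (auto simp: linear_form_defs abs_if)
  moreover have "?s (pair_weight a u1 \<xi>1)"
    by (rule schur_bound_pair_weight1[where \<alpha> = 1 and c = "\<lambda>z. 0" and \<kappa> = 0 and \<beta> = 1 and d = "\<lambda>z. 0"])
      (auto simp: linear_form_defs abs_if)
  moreover have "?s (pair_weight a u1 \<xi>2)"
    by (rule schur_bound_pair_weight3[where \<alpha> = 1 and c = "\<lambda>z. 0" and \<kappa> = 0 and \<beta> = 1 and d = "\<lambda>z. snd z"])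
      (auto simp: linear_form_defs abs_if)
  moreover have "?s (pair_weight a u1 \<xi>3)"
    by (rule schur_bound_pair_weight1[where \<alpha> = 1 and c = "\<lambda>z. 0" and \<kappa> = 0 and \<beta> = 1 and d = "\<lambda>z. snd z"])
      (auto simp: linear_form_defs abs_if)
  moreover have "?s (pair_weight a v2 \<xi>1)"
    by (rule schur_bound_pair_weight3[where \<alpha> = "-1" and c = "\<lambda>z. fst z - snd z" and \<kappa> = 0 and \<beta> = 1 and d = "\<lambda>z. 0"])
      (auto simp: linear_form_defs abs_if)
  moreover have "?s (pair_weight a v2 \<xi>2)"
    by (rule schur_bound_pair_weight2[where \<alpha> = "-1" and c = "\<lambda>z. 0" and \<kappa> = 0 and \<beta> = 1 and d = "\<lambda>z. 0"])
      (auto simp: linear_form_defs abs_if)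
  moreover have "?s (pair_weight a v2 \<xi>3)"
    by (rule schur_bound_pair_weight2[where \<alpha> = "-1" and c = "\<lambda>z. 0" and \<kappa> = 0 and \<beta> = 1 and d = "\<lambda>z. snd z"])
      (auto simp: linear_form_defs abs_if)
  moreover have "?s (pair_weight a u3 \<xi>1)"
    by (rule schur_bound_pair_weight1[where \<alpha> = 1 and c = "\<lambda>z. fst z + snd z" and \<kappa> = 0 and \<beta> = 1 and d = "\<lambda>z. 0"])
      (auto simp: linear_form_defs abs_if)
  moreover have "?s (pair_weight a u3 \<xi>2)"
    by (rule schur_bound_pair_weight2[where \<alpha> = 1 and c = "\<lambda>z. fst z + snd z" and \<kappa> = 0 and \<beta> = 1 and d = "\<lambda>z. 0"])
      (auto simp: linear_form_defs abs_if)
  moreover have "?s (pair_weight a u3 \<xi>3)"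
    by (rule schur_bound_pair_weight2[where \<alpha> = 1 and c = "\<lambda>z. fst z + snd z" and \<kappa> = 0 and \<beta> = 1 and d = "\<lambda>z. snd z"])
      (auto simp: linear_form_defs abs_if)
  moreover have "?s (pair_weight a v3 \<xi>1)"
    by (rule schur_bound_pair_weight1[where \<alpha> = "-1" and c = "\<lambda>z. fst z - snd z" and \<kappa> = 0 and \<beta> = 1 and d = "\<lambda>z. 0"])
      (auto simp: linear_form_defs abs_if)
  moreover have "?s (pair_weight a v3 \<xi>2)"
    by (rule schur_bound_pair_weight2[where \<alpha> = "-1" and c = "\<lambda>z. fst z - snd z" and \<kappa> = 0 and \<beta> = 1 and d = "\<lambda>z. 0"])
      (auto simp: linear_form_defs abs_if)
  moreover have "?s (pair_weight a v3 \<xi>3)"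
    by (rule schur_bound_pair_weight2[where \<alpha> = "-1" and c = "\<lambda>z. fst z - snd z" and \<kappa> = 0 and \<beta> = 1 and d = "\<lambda>z. snd z"])
      (auto simp: linear_form_defs abs_if)
  ultimately show ?thesis
    using assms unfolding transversal_pairs_def by auto
qed

text \<open>Additivity of the integral needs measurability of the partial sums, so both claims are
  carried through one induction.\<close>

lemma trilinear_sum_list:
  assumes [measurable]: "f \<in> borel_measurable borel" "g \<in> borel_measurable borel" "h \<in> borel_measurable borel"
    and "\<And>M. M \<in> set Ms \<Longrightarrow> case_prod M \<in> borel_measurable (lborel \<Otimes>\<^sub>M lborel)"
  shows "case_prod (\<lambda>x y. \<Sum>M\<leftarrow>Ms. M x y) \<in> borel_measurable (lborel \<Otimes>\<^sub>M lborel) \<and>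
    trilinear f g h (\<lambda>x y. \<Sum>M\<leftarrow>Ms. M x y) = (\<Sum>M\<leftarrow>Ms. trilinear f g h M)"
  using assms(4)
proof (induction Ms)
  case Nil
  then show ?case by (simp add: trilinear_def)
next
  case (Cons M Ms)
  then have [measurable]: "case_prod M \<in> borel_measurable (lborel \<Otimes>\<^sub>M lborel)"
    "case_prod (\<lambda>x y. \<Sum>M\<leftarrow>Ms. M x y) \<in> borel_measurable (lborel \<Otimes>\<^sub>M lborel)"
    and eq: "trilinear f g h (\<lambda>x y. \<Sum>M\<leftarrow>Ms. M x y) = (\<Sum>M\<leftarrow>Ms. trilinear f g h M)"
    by auto
  have "trilinear f g h (\<lambda>x y. M x y + (\<Sum>M\<leftarrow>Ms. M x y)) =
      trilinear f g h M + trilinear f g h (\<lambda>x y. \<Sum>M\<leftarrow>Ms. M x y)"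
    unfolding trilinear_def by (simp add: distrib_left nn_integral_add)
  then show ?case
    by (auto simp: eq)
qed

lemma trilinear_transversal_le:
  assumes [measurable]: "f \<in> borel_measurable borel" "g \<in> borel_measurable borel" "h \<in> borel_measurable borel"
    and a: "a > 1 / 2" and nonneg: "0 \<le> p" "0 \<le> q" "0 \<le> r"
    and f: "(\<integral>\<^sup>+x. (f x)\<^sup>2 \<partial>lborel) = ennreal (p\<^sup>2)"
    and g: "(\<integral>\<^sup>+x. (g x)\<^sup>2 \<partial>lborel) = ennreal (q\<^sup>2)"
    and h: "(\<integral>\<^sup>+x. (h x)\<^sup>2 \<partial>lborel) = ennreal (r\<^sup>2)"
  shows "trilinear f g h (\<lambda>x y. \<Sum>(P, Q)\<leftarrow>transversal_pairs. pair_weight a P Q x y) \<le>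
    ennreal (real (length transversal_pairs) * (sqrt (enn2real (pair_weight_const a)) * p * q * r))"
proof -
  let ?k = "enn2real (pair_weight_const a)"
  let ?b = "sqrt ?k * p * q * r"
  have k: "pair_weight_const a = ennreal ?k"
    using pair_weight_const_finite[OF a] by simp
  let ?Ms = "map (\<lambda>(P, Q). pair_weight a P Q) transversal_pairs"
  have Ms: "schur_bound (pair_weight_const a) M" if "M \<in> set ?Ms" for M
    using that schur_bound_transversal by auto
  have each: "trilinear f g h M \<le> ennreal ?b" if "M \<in> set ?Ms" for M
  proof -
    have "(trilinear f g h M)\<^sup>2 \<le> pair_weight_const a * ennreal (p\<^sup>2) * ennreal (q\<^sup>2) * ennreal (r\<^sup>2)"
      using trilinear_le[OF Ms[OF that], of f g h] by (simp add: f g h)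
    also have "\<dots> = ennreal (?b\<^sup>2)"
      by (subst k) (simp add: power_mult_distrib ennreal_mult)
    \<comment> \<open>Squares are compared; an infinite form is excluded because its square would be
      infinite.\<close>
    finally show ?thesis
      using nonneg by (cases "trilinear f g h M") (auto simp: ennreal_power top_unique intro: ennreal_leI power2_le_imp_le)
  qed
  have "(\<lambda>x y. \<Sum>(P, Q)\<leftarrow>transversal_pairs. pair_weight a P Q x y) = (\<lambda>x y. \<Sum>M\<leftarrow>?Ms. M x y)"
    by (simp add: comp_def case_prod_beta')
  then have "trilinear f g h (\<lambda>x y. \<Sum>(P, Q)\<leftarrow>transversal_pairs. pair_weight a P Q x y) = (\<Sum>M\<leftarrow>?Ms. trilinear f g h M)"
    using trilinear_sum_list[of f g h ?Ms] Ms by (auto simp: schur_bound_def)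
  also have "\<dots> \<le> (\<Sum>M\<leftarrow>?Ms. ennreal ?b)"
    using each by (rule sum_list_mono)
  also have "\<dots> = ennreal (real (length transversal_pairs) * ?b)"
    using nonneg by (simp add: sum_list_triv ennreal_mult ennreal_of_nat_eq_real_of_nat)
  finally show ?thesis .
qed

text \<open>Unites the pairs for the two possible forms of the third modulation, \<open>u3\<close>
  and \<open>v3\<close>, so that a single weight serves on the whole frequency space.\<close>

definition total_weight :: "real \<Rightarrow> real \<times> real \<Rightarrow> real \<times> real \<Rightarrow> real" where
  "total_weight a x y = (let w = \<lambda>P. bracket (P x y) powr - a in
     w u1 * w v2 + w u1 * w v3 + w v2 * w u3 + (w u1 + w v2 + w u3 + w v3) * (w \<xi>1 + w \<xi>2 + w \<xi>3))"

lemma sum_pair_weights: "(\<Sum>(P, Q)\<leftarrow>transversal_pairs. pair_weight a P Q x y) = ennreal (total_weight a x y)"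
  unfolding transversal_pairs_def pair_weight_def total_weight_def Let_def
  by (simp add: algebra_simps flip: ennreal_plus)

lemma bracket_le_add3:
  assumes "x = y + z + w \<or> x = - (y + z + w)"
  shows "bracket x \<le> bracket y + bracket z + bracket w"
proof -
  have "bracket x = bracket (y + z + w)"
    using assms bracket_minus by metis
  then show ?thesis
    using bracket_add_le[of "y + z" w] bracket_add_le[of y z] by linarith
qed

lemma bracket_double_le: "bracket (2 * x) \<le> 2 * bracket x"
  using bracket_add_le[of x x] by simp

lemma bracket_le_double: "bracket x \<le> bracket (2 * x)"
  by (rule bracket_mono) simp

lemma (in exponents) weight_bracket_le:
  assumes \<sigma>: "\<sigma>1 + \<sigma>2 + \<sigma>3 = 2 * \<eta>1 \<or> \<sigma>1 + \<sigma>2 + \<sigma>3 = - 2 * \<eta>1" and \<eta>: "\<eta>1 + \<eta>2 + \<eta>3 = 0"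
  shows "bracket \<sigma>1 powr - b1 * bracket \<sigma>2 powr - b2 * bracket \<sigma>3 powr - b3 *
      bracket \<eta>1 powr - s1 * bracket \<eta>2 powr - s2 * bracket \<eta>3 powr - r
    \<le> 2 powr (12 * penalty + 2 * a) *
      (bracket \<sigma>1 powr - a * (bracket \<sigma>2 powr - a + bracket \<sigma>3 powr - a) +
       (bracket \<sigma>1 powr - a + bracket \<sigma>2 powr - a + bracket \<sigma>3 powr - a) *
       (bracket \<eta>1 powr - a + bracket \<eta>2 powr - a + bracket \<eta>3 powr - a))"
proof (rule weight_le)
  have two: "bracket x \<le> bracket y + bracket z" if "x + y + z = 0" for x y z
  proof -
    have "x = - y + - z" using that by linarith
    then show ?thesis
      using bracket_add_le[of "- y" "- z"] unfolding bracket_minus by simp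
  qed
  show "bracket \<eta>1 \<le> bracket \<eta>2 + bracket \<eta>3" "bracket \<eta>2 \<le> bracket \<eta>1 + bracket \<eta>3"
    "bracket \<eta>3 \<le> bracket \<eta>1 + bracket \<eta>2"
    by (rule two; use \<eta> in linarith)+
  have three: "bracket x \<le> bracket y + bracket z + 2 * bracket \<eta>1"
    if "x + y + z = 2 * \<eta>1 \<or> x + y + z = - 2 * \<eta>1" for x y z
  proof -
    have "bracket x \<le> bracket (- y) + bracket (- z) + bracket (2 * \<eta>1)
        \<or> bracket x \<le> bracket (- y) + bracket (- z) + bracket (- (2 * \<eta>1))"
      using that by (intro disj_forward[OF that] bracket_le_add3 disjI1) linarith+
    then show ?thesis
      using bracket_double_le[of \<eta>1] by simp
  qed
  show "bracket \<sigma>1 \<le> bracket \<sigma>2 + bracket \<sigma>3 + 2 * bracket \<eta>1" "bracket \<sigma>2 \<le> bracket \<sigma>1 + bracket \<sigma>3 + 2 * bracket \<eta>1"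
    "bracket \<sigma>3 \<le> bracket \<sigma>1 + bracket \<sigma>2 + 2 * bracket \<eta>1"
    by (rule three; use \<sigma> in linarith)+
  have "bracket (2 * \<eta>1) \<le> bracket \<sigma>1 + bracket \<sigma>2 + bracket \<sigma>3"
    using \<sigma> by (intro bracket_le_add3) linarith
  then show "bracket \<eta>1 \<le> bracket \<sigma>1 + bracket \<sigma>2 + bracket \<sigma>3"
    using bracket_le_double[of \<eta>1] by linarith
qed (rule bracket_ge_1)+

lemma weight_le_total_weight:
  assumes "exponents a b1 b2 b3 s1 s2 r" and "exponents a b2 b1 b3 s2 s1 r"
  obtains C where "C \<ge> 0" "\<And>x y. bracket (u1 x y) powr - b1 * bracket (v2 x y) powr - b2 *
      bracket (\<bar>fst (- x - y)\<bar> - \<bar>snd (- x - y)\<bar>) powr - b3 *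
      bracket (\<xi>1 x y) powr - s1 * bracket (\<xi>2 x y) powr - s2 * bracket (\<xi>3 x y) powr - r
    \<le> C * total_weight a x y"
proof -
  interpret A: exponents a b1 b2 b3 s1 s2 r by fact
  interpret B: exponents a b2 b1 b3 s2 s1 r by fact
  define K where "K = 2 powr (12 * A.penalty + 2 * a)"
  \<comment> \<open>The penalty is symmetric under exchanging the indices 1 and 2, so
    \<open>K\<close> serves both cases.\<close>
  have penalty_eq: "A.penalty = B.penalty" by (simp add: A.penalty_def B.penalty_def)
  have "bracket (u1 x y) powr - b1 * bracket (v2 x y) powr - b2 *
      bracket (\<bar>fst (- x - y)\<bar> - \<bar>snd (- x - y)\<bar>) powr - b3 *
      bracket (\<xi>1 x y) powr - s1 * bracket (\<xi>2 x y) powr - s2 * bracket (\<xi>3 x y) powr - r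
    \<le> K * total_weight a x y" (is "?W \<le> _") for x y
  proof -
    let ?w = "\<lambda>P. bracket (P x y) powr - a"
    let ?z = "- x - y"
    \<comment> \<open>The form \<open>v3\<close> occurs when the two components have the same sign,
      \<open>u3\<close> when the signs are opposite.\<close>
    consider "bracket (\<bar>fst ?z\<bar> - \<bar>snd ?z\<bar>) = bracket (v3 x y)" | "bracket (\<bar>fst ?z\<bar> - \<bar>snd ?z\<bar>) = bracket (u3 x y)"
    proof -
      have "\<bar>\<bar>fst ?z\<bar> - \<bar>snd ?z\<bar>\<bar> = \<bar>v3 x y\<bar> \<or> \<bar>\<bar>fst ?z\<bar> - \<bar>snd ?z\<bar>\<bar> = \<bar>u3 x y\<bar>"
        unfolding linear_form_defs by linarith
      then show thesis using that by (metis bracket_abs)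
    qed
    then show ?thesis
    proof cases
      case 1
      have "?W \<le> K * (?w u1 * (?w v2 + ?w v3) + (?w u1 + ?w v2 + ?w v3) * (?w \<xi>1 + ?w \<xi>2 + ?w \<xi>3))"
        unfolding 1 K_def by (rule A.weight_bracket_le) (simp_all add: linear_form_defs)
      also have "\<dots> \<le> K * total_weight a x y"
        unfolding total_weight_def Let_def
        by (intro mult_left_mono) (simp_all add: K_def algebra_simps)
      finally show ?thesis .
    next
      case 2
      \<comment> \<open>The third modulation now has the null type of the first one, so the second
        modulation takes the distinguished place.\<close>
      have "?W = bracket (v2 x y) powr - b2 * bracket (u1 x y) powr - b1 * bracket (u3 x y) powr - b3 *
          bracket (\<xi>2 x y) powr - s2 * bracket (\<xi>1 x y) powr - s1 * bracket (\<xi>3 x y) powr - r"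
        unfolding 2 by (simp only: ac_simps)
      also have "\<dots> \<le> K * (?w v2 * (?w u1 + ?w u3) + (?w v2 + ?w u1 + ?w u3) * (?w \<xi>2 + ?w \<xi>1 + ?w \<xi>3))"
        unfolding K_def penalty_eq by (rule B.weight_bracket_le) (simp_all add: linear_form_defs)
      also have "\<dots> \<le> K * total_weight a x y"
        unfolding total_weight_def Let_def
        by (intro mult_left_mono) (simp_all add: K_def algebra_simps)
      finally show ?thesis .
    qed
  qed
  then show thesis
    using that[of K] by (simp add: K_def)
qed

section \<open>The norms as square integrals on the frequency side\<close>

lemma bracket_powr_le:
  assumes "\<bar>t\<bar> \<le> 2 * norm w"
  shows "bracket t powr b \<le> 2 ^ nat \<lceil>\<bar>b\<bar>\<rceil> * (1 + norm w) ^ nat \<lceil>\<bar>b\<bar>\<rceil>"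
proof -
  let ?n = "nat \<lceil>\<bar>b\<bar>\<rceil>"
  have "bracket t powr b \<le> bracket t powr real ?n"
    using bracket_ge_1 by (intro powr_mono) (auto simp: of_nat_ceiling order_trans[OF abs_ge_self])
  also have "\<dots> = bracket t ^ ?n"
    by (rule powr_realpow) simp
  also have "\<dots> \<le> (2 * (1 + norm w)) ^ ?n"
    using bracket_le[of t] assms by (intro power_mono) (auto simp: less_imp_le)
  finally show ?thesis
    by (simp only: power_mult_distrib)
qed

lemma borel_measurable_snd_plane [measurable]: "(snd :: real \<times> real \<Rightarrow> real) \<in> borel_measurable borel"
  by (intro borel_measurable_continuous_onI continuous_intros)

text \<open>Rules out that \<open>L2_norm\<close> takes its default value 0. The weights grow at
  most like powers \<open>?m\<close> and \<open>?n\<close>; two further powers of decay become four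
  after squaring, enough for integrability over the plane.\<close>

lemma weighted_fourier_square_integrable:
  fixes \<psi> :: "real \<times> real \<Rightarrow> complex"
  assumes \<psi>: "schwartz \<psi>" and [measurable]: "p \<in> borel_measurable borel"
    and p: "\<And>w. \<bar>p w\<bar> \<le> 2 * norm w"
  shows "integrable lborel (\<lambda>w. (bracket (p w) powr b * bracket (snd w) powr s * norm (fourier \<psi> w))\<^sup>2)"
proof -
  let ?m = "nat \<lceil>\<bar>b\<bar>\<rceil>" and ?n = "nat \<lceil>\<bar>s\<bar>\<rceil>"
  let ?F = "\<lambda>w. bracket (p w) powr b * bracket (snd w) powr s * norm (fourier \<psi> w)"
  note [measurable] = fourier_measurable[OF schwartz_measurable[OF \<psi>]]
  obtain B where B: "\<And>w. (1 + norm w) ^ (2 + ?m + ?n) * norm (fourier \<psi> w) \<le> B"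
    using fourier_decay[OF \<psi>] by blast
  have le: "(1 + norm w) ^ 2 * ?F w \<le> 2 ^ (?m + ?n) * B" for w
  proof -
    have "\<bar>snd w\<bar> \<le> 2 * norm w"
      using norm_snd_le[of "snd w" "fst w"] by simp
    then have "(1 + norm w) ^ 2 * ?F w \<le>
        (1 + norm w) ^ 2 * ((2 ^ ?m * (1 + norm w) ^ ?m) * (2 ^ ?n * (1 + norm w) ^ ?n) * norm (fourier \<psi> w))"
      using p[of w] by (intro mult_left_mono mult_right_mono mult_mono bracket_powr_le) auto
    also have "\<dots> = 2 ^ (?m + ?n) * ((1 + norm w) ^ (2 + ?m + ?n) * norm (fourier \<psi> w))"
      by (simp only: power_add ac_simps)
    also have "\<dots> \<le> 2 ^ (?m + ?n) * B"
      using B by (intro mult_left_mono) auto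
    finally show ?thesis .
  qed
  show ?thesis
  proof (rule integrable_of_decay)
    fix w
    have "(1 + norm w) ^ 4 * norm ((?F w)\<^sup>2) = ((1 + norm w) ^ 2 * ?F w)\<^sup>2"
      by (simp add: power_mult_distrib flip: power_mult)
    also have "\<dots> \<le> (2 ^ (?m + ?n) * B)\<^sup>2"
      using le by (intro power_mono) auto
    finally show "(1 + norm w) ^ 4 * norm ((?F w)\<^sup>2) \<le> (2 ^ (?m + ?n) * B)\<^sup>2" .
  qed measurable
qed

lemma nn_integral_weighted_fourier:
  fixes \<psi> :: "real \<times> real \<Rightarrow> complex"
  assumes "schwartz \<psi>" "p \<in> borel_measurable borel" "\<And>w. \<bar>p w\<bar> \<le> 2 * norm w"
  shows "(\<integral>\<^sup>+w. (ennreal (bracket (p w) powr b * bracket (snd w) powr s * norm (fourier \<psi> w)))\<^sup>2 \<partial>lborel) =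
    ennreal ((L2_norm (\<lambda>w. (bracket (p w) powr b * bracket (snd w) powr s) *\<^sub>R fourier \<psi> w))\<^sup>2)"
proof -
  have "(L2_norm (\<lambda>w. (bracket (p w) powr b * bracket (snd w) powr s) *\<^sub>R fourier \<psi> w))\<^sup>2 =
      (LINT w|lborel. (bracket (p w) powr b * bracket (snd w) powr s * norm (fourier \<psi> w))\<^sup>2)"
    by (simp add: L2_norm_def abs_mult)
  then show ?thesis
    using nn_integral_eq_integral[OF weighted_fourier_square_integrable[OF assms, of b s]]
    by (simp add: ennreal_power)
qed

lemma L2_norm_nonneg: "0 \<le> L2_norm f"
  by (simp add: L2_norm_def)

lemma X_plus_norm_eq:
  "X_plus_norm s b \<psi> = L2_norm (\<lambda>w. (bracket (fst w + snd w) powr b * bracket (snd w) powr s) *\<^sub>R fourier \<psi> w)"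
  unfolding X_plus_norm_def by (simp add: case_prod_beta')

lemma X_minus_norm_eq:
  "X_minus_norm s b \<psi> = L2_norm (\<lambda>w. (bracket (fst w - snd w) powr b * bracket (snd w) powr s) *\<^sub>R fourier \<psi> w)"
  unfolding X_minus_norm_def by (simp add: case_prod_beta')

lemma H_norm_eq:
  "H_norm s b \<psi> = L2_norm (\<lambda>w. (bracket (\<bar>fst w\<bar> - \<bar>snd w\<bar>) powr b * bracket (snd w) powr s) *\<^sub>R fourier \<psi> w)"
  unfolding H_norm_def by (simp add: case_prod_beta')

text \<open>The weights of the norms are moved into the functions \<open>F1\<close>,
  \<open>F2\<close>, \<open>F3\<close>, whose square integrals are the squared norms. The inverse
  weights remain as the weight of the form, which is dominated by the transversal pairs.\<close>

lemma trilinear_estimate: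
  assumes a: "a > 1 / 2" and exps: "exponents a b1 b2 b3 s1 s2 r" "exponents a b2 b1 b3 s2 s1 r"
  shows "\<exists>C::real. \<forall>\<psi>1 \<psi>2 \<psi>3 :: real \<times> real \<Rightarrow> complex.
    schwartz \<psi>1 \<and> schwartz \<psi>2 \<and> schwartz \<psi>3 \<longrightarrow>
    norm (LINT z|lborel. \<psi>1 z * \<psi>2 z * \<psi>3 z)
      \<le> C * X_plus_norm s1 b1 \<psi>1 * X_minus_norm s2 b2 \<psi>2 * H_norm r b3 \<psi>3"
proof -
  obtain C where C: "C \<ge> 0" and W: "\<And>x y. bracket (u1 x y) powr - b1 * bracket (v2 x y) powr - b2 *
      bracket (\<bar>fst (- x - y)\<bar> - \<bar>snd (- x - y)\<bar>) powr - b3 *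
      bracket (\<xi>1 x y) powr - s1 * bracket (\<xi>2 x y) powr - s2 * bracket (\<xi>3 x y) powr - r
    \<le> C * total_weight a x y"
    by (rule weight_le_total_weight[OF exps]) (rule that)
  define K where "K = C * (real (length transversal_pairs) * sqrt (enn2real (pair_weight_const a)))"
  show ?thesis
  proof (intro exI[of _ K] allI impI, elim conjE)
    fix \<psi>1 \<psi>2 \<psi>3 :: "real \<times> real \<Rightarrow> complex"
    assume S: "schwartz \<psi>1" "schwartz \<psi>2" "schwartz \<psi>3"
    let ?n1 = "X_plus_norm s1 b1 \<psi>1" and ?n2 = "X_minus_norm s2 b2 \<psi>2" and ?n3 = "H_norm r b3 \<psi>3"
    define \<omega> where "\<omega> = (\<lambda>(p :: real \<times> real \<Rightarrow> real) b s w. bracket (p w) powr b * bracket (snd w) powr s)"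
    define p1 p2 p3 :: "real \<times> real \<Rightarrow> real" where "p1 = (\<lambda>w. fst w + snd w)" and "p2 = (\<lambda>w. fst w - snd w)"
      and "p3 = (\<lambda>w. \<bar>fst w\<bar> - \<bar>snd w\<bar>)"
    note p_defs = p1_def p2_def p3_def
    have pm [measurable]: "p1 \<in> borel_measurable borel" "p2 \<in> borel_measurable borel" "p3 \<in> borel_measurable borel"
      unfolding p_defs by (intro borel_measurable_continuous_onI continuous_intros)+
    note [measurable] = S[THEN schwartz_measurable, THEN fourier_measurable]
    have p: "\<bar>p1 w\<bar> \<le> 2 * norm w" "\<bar>p2 w\<bar> \<le> 2 * norm w" "\<bar>p3 w\<bar> \<le> 2 * norm w" for w
      using norm_fst_le[of "fst w" "snd w"] norm_snd_le[of "snd w" "fst w"] unfolding p_defs by simp_all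
    define F1 F2 F3 where "F1 = (\<lambda>w. ennreal (\<omega> p1 b1 s1 w * norm (fourier \<psi>1 w)))"
      and "F2 = (\<lambda>w. ennreal (\<omega> p2 b2 s2 w * norm (fourier \<psi>2 w)))"
      and "F3 = (\<lambda>w. ennreal (\<omega> p3 b3 r w * norm (fourier \<psi>3 w)))"
    note F_defs = F1_def F2_def F3_def
    have [measurable]: "F1 \<in> borel_measurable borel" "F2 \<in> borel_measurable borel" "F3 \<in> borel_measurable borel"
      unfolding F_defs \<omega>_def by measurable
    have F: "(\<integral>\<^sup>+w. (F1 w)\<^sup>2 \<partial>lborel) = ennreal (?n1\<^sup>2)" "(\<integral>\<^sup>+w. (F2 w)\<^sup>2 \<partial>lborel) = ennreal (?n2\<^sup>2)"
      "(\<integral>\<^sup>+w. (F3 w)\<^sup>2 \<partial>lborel) = ennreal (?n3\<^sup>2)"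
      using nn_integral_weighted_fourier[OF S(1) pm(1) p(1), of b1 s1]
        nn_integral_weighted_fourier[OF S(2) pm(2) p(2), of b2 s2]
        nn_integral_weighted_fourier[OF S(3) pm(3) p(3), of b3 r]
      unfolding F_defs \<omega>_def X_plus_norm_eq X_minus_norm_eq H_norm_eq p_defs by blast+
    have nonneg: "0 \<le> ?n1" "0 \<le> ?n2" "0 \<le> ?n3"
      by (simp_all add: X_plus_norm_eq X_minus_norm_eq H_norm_eq L2_norm_nonneg)
    have pointwise: "ennreal (norm (fourier \<psi>1 x)) * ennreal (norm (fourier \<psi>2 y)) * ennreal (norm (fourier \<psi>3 (- x - y))) * 1
        \<le> ennreal C * (F1 x * F2 y * F3 (- x - y) * (\<Sum>(P, Q)\<leftarrow>transversal_pairs. pair_weight a P Q x y))" for x y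
    proof -
      let ?f = "norm (fourier \<psi>1 x)" and ?g = "norm (fourier \<psi>2 y)" and ?h = "norm (fourier \<psi>3 (- x - y))"
      let ?\<Omega> = "\<omega> p1 b1 s1 x * \<omega> p2 b2 s2 y * \<omega> p3 b3 r (- x - y)"
      have tot: "0 \<le> total_weight a x y" by (simp add: total_weight_def Let_def)
      have pos: "0 \<le> \<omega> q b s w" for q b s w by (simp add: \<omega>_def)
      have cancel: "bracket t powr b * bracket t powr - b = 1" for t b
        by (simp add: bracket_pos[THEN less_imp_neq, symmetric] flip: powr_add)
      let ?W = "bracket (u1 x y) powr - b1 * bracket (v2 x y) powr - b2 *
        bracket (\<bar>fst (- x - y)\<bar> - \<bar>snd (- x - y)\<bar>) powr - b3 *
        bracket (\<xi>1 x y) powr - s1 * bracket (\<xi>2 x y) powr - s2 * bracket (\<xi>3 x y) powr - r"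
      \<comment> \<open>Brackets are positive, so each power cancels against its inverse and the
        product inserts the number 1 into the integrand.\<close>
      have "?\<Omega> * ?W =
        (bracket (u1 x y) powr b1 * bracket (u1 x y) powr - b1) * (bracket (v2 x y) powr b2 * bracket (v2 x y) powr - b2) *
        (bracket (p3 (- x - y)) powr b3 * bracket (p3 (- x - y)) powr - b3) *
        (bracket (\<xi>1 x y) powr s1 * bracket (\<xi>1 x y) powr - s1) * (bracket (\<xi>2 x y) powr s2 * bracket (\<xi>2 x y) powr - s2) *
        (bracket (\<xi>3 x y) powr r * bracket (\<xi>3 x y) powr - r)"
        unfolding \<omega>_def p_defs linear_form_defs by (simp only: ac_simps)
      also have "\<dots> = 1"
        unfolding cancel by simp
      finally have "1 = ?\<Omega> * ?W" ..
      also have "\<dots> \<le> ?\<Omega> * (C * total_weight a x y)"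
        using W[of x y] pos by (intro mult_left_mono) auto
      finally have "(?f * ?g * ?h) * 1 \<le> (?f * ?g * ?h) * (?\<Omega> * (C * total_weight a x y))"
        by (intro mult_left_mono) auto
      then have "ennreal (?f * ?g * ?h) \<le> ennreal (C * ((\<omega> p1 b1 s1 x * ?f) * (\<omega> p2 b2 s2 y * ?g) * (\<omega> p3 b3 r (- x - y) * ?h) * total_weight a x y))"
        by (intro ennreal_leI) (simp add: ac_simps)
      then show ?thesis
        unfolding sum_pair_weights F_defs using C tot pos by (simp add: ennreal_mult)
    qed
    have "ennreal (norm (LINT z|lborel. \<psi>1 z * \<psi>2 z * \<psi>3 z)) \<le>
        trilinear (\<lambda>w. norm (fourier \<psi>1 w)) (\<lambda>w. norm (fourier \<psi>2 w)) (\<lambda>w. norm (fourier \<psi>3 w)) (\<lambda>x y. 1)"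
      using S by (rule triple_product_le)
    also have "\<dots> \<le> (\<integral>\<^sup>+x. \<integral>\<^sup>+y. ennreal C * (F1 x * F2 y * F3 (- x - y) * (\<Sum>(P, Q)\<leftarrow>transversal_pairs. pair_weight a P Q x y)) \<partial>lborel \<partial>lborel)"
      unfolding trilinear_def by (intro nn_integral_mono pointwise)
    also have "\<dots> = ennreal C * trilinear F1 F2 F3 (\<lambda>x y. \<Sum>(P, Q)\<leftarrow>transversal_pairs. pair_weight a P Q x y)"
    proof -
      have [measurable]: "case_prod (\<lambda>x y. ennreal (total_weight a x y)) \<in> borel_measurable (lborel \<Otimes>\<^sub>M lborel)"
        unfolding total_weight_def Let_def by measurable
      show ?thesis
        unfolding trilinear_def sum_pair_weights by (simp add: nn_integral_cmult)
    qed
    also have "\<dots> \<le> ennreal C * ennreal (real (length transversal_pairs) * (sqrt (enn2real (pair_weight_const a)) * ?n1 * ?n2 * ?n3))"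
      using nonneg F by (intro mult_left_mono trilinear_transversal_le a) auto
    also have "\<dots> = ennreal (K * ?n1 * ?n2 * ?n3)"
      using C nonneg by (simp add: K_def mult.assoc flip: ennreal_mult)
    finally show "norm (LINT z|lborel. \<psi>1 z * \<psi>2 z * \<psi>3 z) \<le> K * ?n1 * ?n2 * ?n3"
      using C nonneg by (subst (asm) ennreal_le_iff) (auto simp: K_def)
  qed
qed

section \<open>Ordered exponents and the choice of \<open>a\<close>\<close>

lemma med3_props:
  "Max {a, b, c} + med3 a b c + Min {a, b, c} = a + b + c"
  "Min {a, b, c} \<le> a" "Min {a, b, c} \<le> b" "Min {a, b, c} \<le> c"
  "Min {a, b, c} + med3 a b c \<le> a + b" "Min {a, b, c} + med3 a b c \<le> a + c" "Min {a, b, c} + med3 a b c \<le> b + c"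
  by (auto simp: med3_def min_def max_def)

theorem corollary2:
  fixes r s1 s2 b1 b2 b3 :: real
  assumes "b1 + b2 + b3 > 1 / 2"
    and "b1 + b2 > 0" and "b1 + b3 > 0" and "b2 + b3 > 0"
    and "s1 + r \<ge> 0" and "s2 + r \<ge> 0"
    and "s1 + r > - Min {b1, b2, b3}" and "s2 + r > - Min {b1, b2, b3}"
    and "s1 + s2 > - Min {b1, b2, b3}"
    and "s1 + s2 > 1 / 2 - b1 - b2 - b3"
    and "s1 + s2 + r > 1 / 2 - b1" and "s1 + s2 + r > 1 / 2 - b2"
    and "s1 + s2 + r >
      pos_part (1 / 2 - Max {b1, b2, b3}) + pos_part (1 / 2 - med3 b1 b2 b3) - Min {b1, b2, b3}"
  shows "\<exists>C::real. \<forall>\<psi>1 \<psi>2 \<psi>3 :: real \<times> real \<Rightarrow> complex.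
    schwartz \<psi>1 \<and> schwartz \<psi>2 \<and> schwartz \<psi>3 \<longrightarrow>
    norm (LINT z|lborel. \<psi>1 z * \<psi>2 z * \<psi>3 z)
      \<le> C * X_plus_norm s1 b1 \<psi>1 * X_minus_norm s2 b2 \<psi>2 * H_norm r b3 \<psi>3"
proof -
  define m M d where "m = Min {b1, b2, b3}" and "M = Max {b1, b2, b3}" and "d = med3 b1 b2 b3"
  note props = med3_props[where a = b1 and b = b2 and c = b3, folded m_def M_def d_def]
  have pp: "pos_part x \<ge> 0" "pos_part x \<ge> x" for x by (simp_all add: pos_part_def)
  note h = assms[folded m_def M_def d_def]
  \<comment> \<open>The last hypothesis is read in three ways: each positive part may be replaced by
    0 or by its argument. Dropping both, keeping the median part and keeping both yield the bounds
    for one, two and three modulations.\<close>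
  have S0: "s1 + s2 + r > - m" and Sd: "s1 + s2 + r > 1 / 2 - d - m" and S3: "s1 + s2 + r > 1 - M - d - m"
    using h(13) pp[of "1 / 2 - M"] pp[of "1 / 2 - d"] by linarith+
  \<comment> \<open>All quantities that have to be at least \<open>a\<close>; the last is halved
    because its lower bound is \<open>2 * a\<close>. Each exceeds 1/2, hence so does their
    minimum.\<close>
  let ?A = "{b1 + b2 + b3, s1 + s2 + b1 + b2 + b3, s1 + s2 + r + b1, s1 + s2 + r + b2,
    s1 + s2 + r + b1 + b2, s1 + s2 + r + b1 + b3, s1 + s2 + r + b2 + b3, (s1 + s2 + r + b1 + b2 + b3) / 2}"
  define a where "a = Min ?A"
  have "s1 + s2 + r + b1 + b2 + b3 > 1"
    using S3 props(1) by linarith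
  then have "(s1 + s2 + r + b1 + b2 + b3) / 2 > 1 / 2"
    by simp
  moreover have "s1 + s2 + b1 + b2 + b3 > 1 / 2" "s1 + s2 + r + b1 > 1 / 2" "s1 + s2 + r + b2 > 1 / 2"
    "s1 + s2 + r + b1 + b2 > 1 / 2" "s1 + s2 + r + b1 + b3 > 1 / 2" "s1 + s2 + r + b2 + b3 > 1 / 2"
    using h(10-12) Sd props(5-7) by linarith+
  ultimately have "\<forall>x\<in>?A. x > 1 / 2"
    using h(1) unfolding ball_simps by blast
  then have a: "a > 1 / 2"
    unfolding a_def by (subst Min_gr_iff) blast+
  have "\<forall>x\<in>?A. a \<le> x"
    unfolding a_def by (intro ballI Min_le) blast+
  then have le: "a \<le> b1 + b2 + b3" "a \<le> s1 + s2 + b1 + b2 + b3" "a \<le> s1 + s2 + r + b1" "a \<le> s1 + s2 + r + b2"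
    "a \<le> s1 + s2 + r + b1 + b2" "a \<le> s1 + s2 + r + b1 + b3" "a \<le> s1 + s2 + r + b2 + b3"
    "a \<le> (s1 + s2 + r + b1 + b2 + b3) / 2"
    unfolding ball_simps by blast+
  have le2: "2 * a \<le> s1 + s2 + r + b1 + b2 + b3"
    using le(8) by simp
  \<comment> \<open>Each of \<open>b1\<close>, \<open>b2\<close>, \<open>b3\<close> is at least
    \<open>m\<close>, so one general statement yields all conditions on a single modulation, for
    both orders of the indices 1 and 2.\<close>
  have "s1 + r + b \<ge> 0 \<and> s2 + r + b \<ge> 0 \<and> s1 + s2 + b \<ge> 0 \<and> s1 + s2 + r + b \<ge> 0" if "m \<le> b" for b
    using h(7-9) S0 that by auto
  note single = this[OF props(2)] this[OF props(3)] this[OF props(4)]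
  have "a > 0" using a by simp
  note facts = this le(1-7) le2 h(2-4)[THEN less_imp_le] h(5,6) single
  have exps: "exponents a b1 b2 b3 s1 s2 r" "exponents a b2 b1 b3 s2 s1 r"
    by (unfold_locales; insert facts; simp only: ac_simps)+
  show ?thesis
    using a exps by (rule trilinear_estimate)
qed

end
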